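(* Let $m\in\mathbb{R}\setminus\{0,-1\}$, $\Gamma_1=\Gamma_2=1$, $\Gamma_3=\Gamma_4=m$, and let $\widetilde{\mathcal{E}}$ be the system of equations described in the context (in the unknowns $s_{ij}=r_{ij}^2$, with $\lambda'=-1$). For each value of $m\in(-\infty,-2)\cup(-\frac12,0)\cup(0,\infty)$, the system $\widetilde{\mathcal{E}}$ has exactly four (real, positive) solutions that correspond to symmetric kite configurations. If $m\in(0,\infty)$, such configurations are concave. If $m\in(-\frac12,0)$, then there are two convex configurations with $\Gamma_3$ and $\Gamma_4$ on the axis of symmetry, and two concave ones with $\Gamma_1$ and $\Gamma_2$ on the axis of symmetry. If $m\in(-\infty,-2)$, the situation is reversed: there are two concave configurations with $\Gamma_3$ and $\Gamma_4$ on the axis of symmetry, and two convex ones with $\Gamma_1$ and $\Gamma_2$ on the axis of symmetry. There are no other strictly kite configurations with $\lambda'<0$ for other values of $m$.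
   Context: Four point vortices have distinct positions $x_i\in\mathbb{R}^2$ and strengths $\Gamma_i\ne0$; $r_{ij}=\|x_i-x_j\|$, $s_{ij}=s_{ji}=r_{ij}^2$, $s_{ii}=0$, $\Gamma=\sum_i\Gamma_i$. A relative equilibrium satisfies $-\lambda(x_i-c)=\sum_{j\ne i}\frac{\Gamma_j}{r_{ij}^2}(x_j-x_i)$ for all $i$, for some $\lambda\in\mathbb{R}\setminus\{0\}$, $c\in\mathbb{R}^2$; put $\lambda'=-\lambda/\Gamma$. When $\lambda'<0$ one may rescale so that $\lambda'=-1$. With $S_{ij}=\frac1{s_{ij}}+\lambda'$ for $i\ne j$ and $S_{ii}=0$, the system $\widetilde{\mathcal{E}}$ consists, with $\lambda'=-1$, of: the Albouy-Chenciner equations $\sum_{k=1}^4\Gamma_k[S_{ik}(s_{jk}-s_{ik}-s_{ij})+S_{jk}(s_{ik}-s_{jk}-s_{ij})]=0$ ($1\le i<j\le4$); the unsymmetrized Albouy-Chenciner equations $\sum_{k=1}^4\Gamma_kS_{ik}(s_{jk}-s_{ik}-s_{ij})=0$ ($i\neq j$); the vanishing of the Cayley-Menger determinant $$\begin{vmatrix}0&1&1&1&1\\1&0&s_{12}&s_{13}&s_{14}\\1&s_{12}&0&s_{23}&s_{24}\\1&s_{13}&s_{23}&0&s_{34}\\1&s_{14}&s_{24}&s_{34}&0\end{vmatrix}=0;$$ and the Dziobek equations $(s_{12}^{-1}+\lambda')(s_{34}^{-1}+\lambda')=(s_{13}^{-1}+\lambda')(s_{24}^{-1}+\lambda')=(s_{14}^{-1}+\lambda')(s_{23}^{-1}+\lambda')$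 (all with denominators cleared). A kite configuration is one with two vortices on an axis of symmetry and the other two symmetrically located with respect to this axis. Here (strictly) kite configurations exclude rhombi: with vortices 3 and 4 on the axis this means $s_{23}=s_{13}$, $s_{24}=s_{14}$, $s_{13}\ne s_{14}$; with vortices 1 and 2 on the axis it means $s_{14}=s_{13}$, $s_{24}=s_{23}$, $s_{13}\neq s_{23}$. A configuration with no three collinear vortices is concave if one vortex lies strictly inside the convex hull of the other three, and convex if no vortex lies in the convex hull of the other three. Solutions are counted in terms of the mutual distances, so mirror images are not distinguished. *)

theory Defs
  imports "HOL-Analysis.Analysis"
begin

text \<open>
  Vortices are indexed by the numeral type \<open>4\<close>, whose elements are \<open>1, 2, 3\<close> and \<open>4\<close>;
  in that type \<open>4 = 0\<close>, so its linear order is not the usual order of the labels and is not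
  used below.
\<close>

definition vortex_strength :: "real \<Rightarrow> 4 \<Rightarrow> real" where
  "vortex_strength m i = (if i = 1 \<or> i = 2 then 1 else m)"

definition lambda_prime :: "(4 \<Rightarrow> real) \<Rightarrow> real \<Rightarrow> real" where
  "lambda_prime \<Gamma> lam = - lam / (\<Sum>i\<in>UNIV. \<Gamma> i)"

definition relative_equilibrium ::
    "(4 \<Rightarrow> real) \<Rightarrow> real \<Rightarrow> real^2 \<Rightarrow> (4 \<Rightarrow> real^2) \<Rightarrow> bool" where
  "relative_equilibrium \<Gamma> lam c x \<longleftrightarrow>
     inj x \<and> lam \<noteq> 0 \<and>
     (\<forall>i. - lam *\<^sub>R (x i - c) =
        (\<Sum>j\<in>UNIV - {i}. (\<Gamma> j / (dist (x i) (x j))\<^sup>2) *\<^sub>R (x j - x i)))"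

definition S :: "real \<Rightarrow> (4 \<Rightarrow> 4 \<Rightarrow> real) \<Rightarrow> 4 \<Rightarrow> 4 \<Rightarrow> real" where
  "S lam' s i j = (if i = j then 0 else 1 / s i j + lam')"

text \<open>The left-hand side is symmetric in \<open>i\<close> and \<open>j\<close> (for symmetric \<open>s\<close>), so \<open>i \<noteq> j\<close> gives the
  same equations as \<open>i < j\<close>.\<close>

definition albouy_chenciner :: "real \<Rightarrow> (4 \<Rightarrow> real) \<Rightarrow> (4 \<Rightarrow> 4 \<Rightarrow> real) \<Rightarrow> bool" where
  "albouy_chenciner lam' \<Gamma> s \<longleftrightarrow>
     (\<forall>i j. i \<noteq> j \<longrightarrow>
        (\<Sum>k\<in>UNIV. \<Gamma> k * (S lam' s i k * (s j k - s i k - s i j)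
                        + S lam' s j k * (s i k - s j k - s i j))) = 0)"

definition unsym_albouy_chenciner :: "real \<Rightarrow> (4 \<Rightarrow> real) \<Rightarrow> (4 \<Rightarrow> 4 \<Rightarrow> real) \<Rightarrow> bool" where
  "unsym_albouy_chenciner lam' \<Gamma> s \<longleftrightarrow>
     (\<forall>i j. i \<noteq> j \<longrightarrow>
        (\<Sum>k\<in>UNIV. \<Gamma> k * S lam' s i k * (s j k - s i k - s i j)) = 0)"

definition cayley_menger :: "(4 \<Rightarrow> 4 \<Rightarrow> real) \<Rightarrow> real" where
  "cayley_menger s = det (vector
     [vector [0, 1, 1, 1, 1],
      vector [1, 0, s 1 2, s 1 3, s 1 4],
      vector [1, s 1 2, 0, s 2 3, s 2 4],
      vector [1, s 1 3, s 2 3, 0, s 3 4],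
      vector [1, s 1 4, s 2 4, s 3 4, 0]] :: real^5^5)"

definition dziobek :: "real \<Rightarrow> (4 \<Rightarrow> 4 \<Rightarrow> real) \<Rightarrow> bool" where
  "dziobek lam' s \<longleftrightarrow>
     (1 / s 1 2 + lam') * (1 / s 3 4 + lam') = (1 / s 1 3 + lam') * (1 / s 2 4 + lam') \<and>
     (1 / s 1 3 + lam') * (1 / s 2 4 + lam') = (1 / s 1 4 + lam') * (1 / s 2 3 + lam')"

text \<open>The system is only ever considered for \<open>s\<close> with positive off-diagonal entries, where it is
  equivalent to its polynomial form with cleared denominators.\<close>

definition E_tilde :: "(4 \<Rightarrow> real) \<Rightarrow> (4 \<Rightarrow> 4 \<Rightarrow> real) \<Rightarrow> bool" where
  "E_tilde \<Gamma> s \<longleftrightarrow>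
     albouy_chenciner (-1) \<Gamma> s \<and> unsym_albouy_chenciner (-1) \<Gamma> s \<and>
     cayley_menger s = 0 \<and> dziobek (-1) s"

definition real_positive_solution :: "(4 \<Rightarrow> real) \<Rightarrow> (4 \<Rightarrow> 4 \<Rightarrow> real) \<Rightarrow> bool" where
  "real_positive_solution \<Gamma> s \<longleftrightarrow>
     (\<forall>i. s i i = 0) \<and> (\<forall>i j. s i j = s j i) \<and> (\<forall>i j. i \<noteq> j \<longrightarrow> 0 < s i j) \<and> E_tilde \<Gamma> s"

definition squared_distances :: "(4 \<Rightarrow> real^2) \<Rightarrow> 4 \<Rightarrow> 4 \<Rightarrow> real" where
  "squared_distances x i j = (dist (x i) (x j))\<^sup>2"

text \<open>Solutions corresponding to planar configurations with property \<open>P\<close>. These are sets of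
  distance functions \<open>s\<close>, so congruent (in particular mirror-image) configurations count once.\<close>

definition solutions_with ::
    "(4 \<Rightarrow> real) \<Rightarrow> ((4 \<Rightarrow> real^2) \<Rightarrow> bool) \<Rightarrow> (4 \<Rightarrow> 4 \<Rightarrow> real) set" where
  "solutions_with \<Gamma> P =
     {s. real_positive_solution \<Gamma> s \<and> (\<exists>x. squared_distances x = s \<and> P x)}"

text \<open>Vortices \<open>k\<close> and \<open>l\<close> lie on an axis of symmetry, namely the perpendicular bisector of the
  other two vortices \<open>i\<close> and \<open>j\<close>; the last condition excludes rhombi.\<close>

definition strictly_kite_on_axis :: "4 \<Rightarrow> 4 \<Rightarrow> (4 \<Rightarrow> real^2) \<Rightarrow> bool" where
  "strictly_kite_on_axis k l x \<longleftrightarrow>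
     (\<exists>i j. {i, j, k, l} = UNIV \<and>
        squared_distances x i k = squared_distances x j k \<and>
        squared_distances x i l = squared_distances x j l \<and>
        squared_distances x i k \<noteq> squared_distances x i l)"

definition strictly_kite :: "(4 \<Rightarrow> real^2) \<Rightarrow> bool" where
  "strictly_kite x \<longleftrightarrow> (\<exists>k l. strictly_kite_on_axis k l x)"

definition no_three_collinear :: "(4 \<Rightarrow> real^2) \<Rightarrow> bool" where
  "no_three_collinear x \<longleftrightarrow>
     (\<forall>i j k. i \<noteq> j \<and> i \<noteq> k \<and> j \<noteq> k \<longrightarrow> \<not> collinear {x i, x j, x k})"

definition concave_configuration :: "(4 \<Rightarrow> real^2) \<Rightarrow> bool" where
  "concave_configuration x \<longleftrightarrow>
     no_three_collinear x \<and> (\<exists>i. x i \<in> interior (convex hull (x ` (UNIV - {i}))))"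

definition convex_configuration :: "(4 \<Rightarrow> real^2) \<Rightarrow> bool" where
  "convex_configuration x \<longleftrightarrow>
     no_three_collinear x \<and> (\<forall>i. x i \<notin> convex hull (x ` (UNIV - {i})))"

end

theory Submission
  imports Defs
begin

text \<open>
  Place a kite so that two vortices sit at \<open>(-a, 0)\<close> and \<open>(a, 0)\<close> and the
  other two on the axis of symmetry at \<open>(0, p)\<close> and \<open>(0, q)\<close>; strictness means
  \<open>p\<^sup>2 \<noteq> q\<^sup>2\<close>. The unsymmetrized Albouy-Chenciner equations say that the vectors
  \<open>\<Sum>k. \<Gamma> k * S i k *\<^sub>R (x k - x i)\<close> vanish, because their left-hand sides are the inner products of
  these vectors with the differences \<open>x j - x i\<close>, which span the plane. Looking at the components
  along and across the axis, one finds that the two off-axis strengths have to agree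
  (\<open>balanced_imp_equal_strengths\<close>), so that (unless \<open>m = 1\<close>) the axis carries either the pair of
  vortices 3, 4 or the pair 1, 2. Let \<open>\<rho>\<close> be the strength on the axis divided by the strength off
  the axis, that is \<open>m\<close> in the first case and \<open>1 / m\<close> in the second. Three scalar equations in
  \<open>u = a\<^sup>2\<close>, \<open>p\<close>, \<open>q\<close> remain (\<open>kite_equations\<close>).

  The variables \<open>w = (u + p\<^sup>2) * (u + q\<^sup>2)\<close> and \<open>D = (p - q)\<^sup>2\<close> decouple these equations
  (\<open>kite_equations_iff\<close>): \<open>u + p * q = w\<close>, \<open>D * (1 + 2 * \<rho> * (1 - w)) = 4 * w * (1 - w)\<close> and
  \<open>(\<rho> + 2) * (1 - D) = 2 * w\<close>. The last one determines \<open>D\<close>, and the middle one becomes the quadratic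
  \<open>kite_poly \<rho> w = 0\<close>. Conversely a root \<open>w\<close> in \<open>(0, 1)\<close> yields a kite precisely when \<open>D\<close> and
  \<open>(p + q)\<^sup>2\<close> come out positive; these \<open>w\<close> form the set \<open>kite_roots \<rho>\<close>. Each of them gives exactly two
  labelled shapes, as either axis vortex may be the one farther from the off-axis pair
  (\<open>solutions_on_axis\<close>). Moreover \<open>p * q\<close> has the sign of \<open>\<rho> / (\<rho> + 2)\<close>, and the kite is concave or
  convex according to whether \<open>p * q\<close> is positive or negative.

  Counting roots is elementary because \<open>kite_poly \<rho> 0 = (\<rho> + 2) * (2 * \<rho> + 1)\<close>,
  \<open>kite_poly \<rho> 1 = \<rho>\<close>, and the discriminant is a positive multiple of
  \<open>(\<rho> + 1) * (\<rho> - 1) * (\<rho>\<^sup>2 - 4 * \<rho> - 9)\<close>. There is one admissible root for \<open>-1/2 < \<rho> < 0\<close> and for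
  \<open>\<rho> < -2\<close>, two for \<open>0 < \<rho> < 1\<close>, none for \<open>\<rho> > 1\<close> and none for \<open>-2 \<le> \<rho> \<le> -1/2\<close>. The
  map \<open>\<rho> \<mapsto> 1 / \<rho>\<close> exchanges the two negative ranges, and for positive \<open>m \<noteq> 1\<close> it exchanges
  a value with two roots and a value with none, so both axes together always carry four solutions.
  At \<open>\<rho> = 1\<close> the two roots merge into \<open>w = 3/4\<close>, the equilateral triangle with one vortex in its
  centre; here every pair of vortices is a possible axis, but the only solutions are the four
  choices of the centre (\<open>card_strictly_kite_equal_strengths\<close>).

  A relative equilibrium with \<open>\<lambda>' < 0\<close> satisfies the same vector equations after rescaling
  (\<open>relative_equilibrium_imp_balanced\<close>), so where \<open>kite_roots m\<close> and \<open>kite_roots (1 / m)\<close> are empty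
  there is no such kite either.
\<close>

section \<open>The scalar equations of a kite\<close>

text \<open>
  The squared distance of the two vortices on the axis, as it follows from \<open>w\<close>: it is the solution \<open>D\<close>
  of \<open>(\<rho> + 2) * (1 - D) = 2 * w\<close>.
\<close>

definition kite_gap :: "real \<Rightarrow> real \<Rightarrow> real" where
  "kite_gap \<rho> w = 1 - 2 * w / (\<rho> + 2)"

text \<open>
  What remains of the equations of a kite after \<open>D\<close> is eliminated: up to the factor \<open>\<rho> + 2\<close> this is
  \<open>D * (1 + 2 * \<rho> * (1 - w)) - 4 * w * (1 - w)\<close> at \<open>D = kite_gap \<rho> w\<close>.
\<close>

definition kite_poly :: "real \<Rightarrow> real \<Rightarrow> real" where
  "kite_poly \<rho> w = 8 * (\<rho> + 1) * w\<^sup>2 - 2 * (\<rho> + 1) * (\<rho> + 5) * w + (\<rho> + 2) * (2 * \<rho> + 1)"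

text \<open>
  The roots that come from real kites. With \<open>P\<close> and \<open>Q\<close> the squared distances of the two axis vortices
  to the off-axis ones, \<open>P + Q = D + 2 * w\<close> and \<open>P * Q = w\<close>. The last condition therefore says that
  \<open>P\<close> and \<open>Q\<close> are real and distinct, which is where strictness of the kite enters. The bounds on
  \<open>w\<close> and \<open>D\<close> make \<open>a\<^sup>2 = w * (1 - w) / D\<close> positive.
\<close>

definition kite_roots :: "real \<Rightarrow> real set" where
  "kite_roots \<rho> = {w. \<rho> \<noteq> -2 \<and> 0 < w \<and> w < 1 \<and> kite_poly \<rho> w = 0 \<and>
     0 < kite_gap \<rho> w \<and> 4 * w < (kite_gap \<rho> w + 2 * w)\<^sup>2}"

text \<open>
  Equilibrium of the kite with vortices of strength 1 at \<open>(\<plusminus>sqrt u, 0)\<close> and of strength \<open>\<rho>\<close> at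
  \<open>(0, p)\<close> and \<open>(0, q)\<close>: the two components for an off-axis vortex, then the component along the axis
  for the vortex at \<open>(0, p)\<close>. The other components vanish by symmetry or follow from these.
\<close>

definition kite_equations :: "real \<Rightarrow> real \<Rightarrow> real \<Rightarrow> real \<Rightarrow> bool" where
  "kite_equations \<rho> u p q \<longleftrightarrow>
     2 * (1 / (4 * u) - 1) + \<rho> * ((1 / (u + p\<^sup>2) - 1) + (1 / (u + q\<^sup>2) - 1)) = 0 \<and>
     (1 / (u + p\<^sup>2) - 1) * p + (1 / (u + q\<^sup>2) - 1) * q = 0 \<and>
     2 * (1 / (u + p\<^sup>2) - 1) * p + \<rho> * (1 / (p - q)\<^sup>2 - 1) * (p - q) = 0"

lemma kite_gap_poly:
  assumes "\<rho> \<noteq> -2"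
  shows "kite_gap \<rho> w * (1 + 2 * \<rho> * (1 - w)) = 4 * w * (1 - w) \<longleftrightarrow> kite_poly \<rho> w = 0"
proof -
  have "\<rho> + 2 \<noteq> 0" using assms by simp
  have "(\<rho> + 2) * kite_gap \<rho> w = \<rho> + 2 - 2 * w"
    using \<open>\<rho> + 2 \<noteq> 0\<close> by (simp add: kite_gap_def right_diff_distrib)
  hence "(\<rho> + 2) * (kite_gap \<rho> w * (1 + 2 * \<rho> * (1 - w)) - 4 * w * (1 - w)) = kite_poly \<rho> w"
    unfolding kite_poly_def by algebra
  thus ?thesis using \<open>\<rho> + 2 \<noteq> 0\<close> by (metis eq_iff_diff_eq_0 mult_eq_0_iff)
qed

text \<open>
  The substitution that makes the problem tractable. Multiplied by \<open>w\<close>, the second equation factors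
  as \<open>(p + q) * (u + p * q - w) = 0\<close>, and \<open>p + q \<noteq> 0\<close> for a strict kite. The identity
  \<open>w = (u + p * q)\<^sup>2 + u * D\<close> then gives \<open>u * D = w * (1 - w)\<close>, so everything symmetric in \<open>p\<close> and
  \<open>q\<close> becomes a function of \<open>w\<close> and \<open>D\<close>, and the other two equations simplify.
\<close>

lemma kite_equations_iff:
  assumes u: "u > 0" and pq: "p \<noteq> q" and strict: "p + q \<noteq> 0"
  defines "w \<equiv> (u + p\<^sup>2) * (u + q\<^sup>2)" and "D \<equiv> (p - q)\<^sup>2"
  shows "kite_equations \<rho> u p q \<longleftrightarrow>
    u + p * q = w \<and> D * (1 + 2 * \<rho> * (1 - w)) = 4 * w * (1 - w) \<and> (\<rho> + 2) * (1 - D) = 2 * w"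
proof -
  define P Q where "P = u + p\<^sup>2" and "Q = u + q\<^sup>2"
  have P: "P > 0" and Q: "Q > 0" using u by (simp_all add: P_def Q_def add_pos_nonneg)
  have w: "w = P * Q" by (simp add: w_def P_def Q_def)
  have w0: "w > 0" using P Q w by simp
  have D0: "D > 0" using pq by (simp add: D_def)
  have "P * Q * ((1 / P - 1) * p + (1 / Q - 1) * q) = p * Q + q * P - (p + q) * (P * Q)"
    using P Q by (simp add: field_simps)
  also have "\<dots> = (p + q) * (u + p * q - w)"
    unfolding w P_def Q_def by algebra
  finally have e2: "P * Q * ((1 / P - 1) * p + (1 / Q - 1) * q) = (p + q) * (u + p * q - w)" .
  hence iff2: "(1 / P - 1) * p + (1 / Q - 1) * q = 0 \<longleftrightarrow> u + p * q = w"
    using P Q strict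
    by (metis eq_iff_diff_eq_0 less_irrefl mult_eq_0_iff)
  have iff13: "(2 * (1 / (4 * u) - 1) + \<rho> * ((1 / P - 1) + (1 / Q - 1)) = 0
         \<longleftrightarrow> D * (1 + 2 * \<rho> * (1 - w)) = 4 * w * (1 - w)) \<and>
       (2 * (1 / P - 1) * p + \<rho> * (1 / D - 1) * (p - q) = 0 \<longleftrightarrow> (\<rho> + 2) * (1 - D) = 2 * w)"
    if h: "u + p * q = w"
  proof -
    have uD: "u * D = w * (1 - w)"
      using h unfolding w_def D_def by algebra
    hence w1: "w < 1" using u D0 w0
      by (metis diff_gt_0_iff_gt mult_pos_pos zero_less_mult_pos)
    have ue: "1 / u = D / (w * (1 - w))"
      using uD u D0 w0 w1 by (simp add: field_simps)
    have "1 / P + 1 / Q = (P + Q) / w" using P Q by (simp add: w field_simps)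
    also have "P + Q = D + 2 * w" unfolding h[symmetric] P_def Q_def D_def by (simp add: power2_eq_square algebra_simps)
    finally have KL: "1 / P + 1 / Q = D / w + 2" using w0 by (simp add: field_simps)
    have "2 * (1 / (4 * u) - 1) + \<rho> * ((1 / P - 1) + (1 / Q - 1)) = (1 / u) / 2 - 2 + \<rho> * (D / w)"
      using KL by (simp add: algebra_simps flip: distrib_left)
    also have "\<dots> * (2 * w * (1 - w)) = D * (1 + 2 * \<rho> * (1 - w)) - 4 * w * (1 - w)"
      unfolding ue using w0 w1 by (simp add: field_simps)
    finally have iff1: "2 * (1 / (4 * u) - 1) + \<rho> * ((1 / P - 1) + (1 / Q - 1)) = 0
         \<longleftrightarrow> D * (1 + 2 * \<rho> * (1 - w)) = 4 * w * (1 - w)"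
      using w0 w1 by auto
    have "w * ((1 / P - 1) * p) = p * Q - w * p" unfolding w using P by (simp add: field_simps)
    also have "\<dots> = - (p * q) * (p - q)" unfolding h[symmetric] Q_def by (simp add: power2_eq_square algebra_simps)
    finally have Kp: "(1 / P - 1) * p = - (p * q) * (p - q) / w" using w0 by (simp add: field_simps)
    have Dpq: "D * (p * q) = w * (D - 1 + w)" using uD h by algebra
    have "2 * (1 / P - 1) * p + \<rho> * (1 / D - 1) * (p - q)
        = 2 * ((1 / P - 1) * p) + \<rho> * (1 / D - 1) * (p - q)" by simp
    also have "\<dots> = (p - q) * (\<rho> * (1 / D - 1) - 2 * ((p * q) / w))"
      unfolding Kp by (simp add: algebra_simps diff_divide_distrib)
    also have "(p * q) / w = (D - 1 + w) / D" using Dpq D0 w0 by (simp add: field_simps)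
    also have "(p - q) * (\<rho> * (1 / D - 1) - 2 * ((D - 1 + w) / D)) * D
        = (p - q) * ((\<rho> + 2) * (1 - D) - 2 * w)"
      using D0 by (simp add: field_simps)
    finally show ?thesis using iff1 pq D0 by auto
  qed
  show ?thesis
    unfolding kite_equations_def P_def[symmetric] Q_def[symmetric] D_def[symmetric]
    using iff2 iff13 by blast
qed

text \<open>
  From a kite to its root. The last identity, \<open>p * q = \<rho> * w\<^sup>2 / ((\<rho> + 2) * D)\<close>, decides whether the two
  axis vortices lie on the same side of the off-axis pair, hence whether the kite is concave.
\<close>

lemma kite_equations_roots:
  assumes u: "u > 0" and pq: "p \<noteq> q" and strict: "p + q \<noteq> 0" and \<rho>: "\<rho> \<noteq> 0"
    and eq: "kite_equations \<rho> u p q"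
  defines "w \<equiv> (u + p\<^sup>2) * (u + q\<^sup>2)"
  shows "w \<in> kite_roots \<rho>" "(p - q)\<^sup>2 = kite_gap \<rho> w" 
    "(u + p\<^sup>2) + (u + q\<^sup>2) = kite_gap \<rho> w + 2 * w" 
    "4 * u = 4 * w * (1 - w) / kite_gap \<rho> w"
    "p * q * ((\<rho> + 2) * kite_gap \<rho> w) = \<rho> * w\<^sup>2"
proof -
  define D where "D = (p - q)\<^sup>2"
  have h: "u + p * q = w" "D * (1 + 2 * \<rho> * (1 - w)) = 4 * w * (1 - w)" "(\<rho> + 2) * (1 - D) = 2 * w"
    using eq unfolding kite_equations_iff[OF u pq strict] w_def D_def by blast+
  have w0: "w > 0" using u by (simp add: w_def add_pos_nonneg)
  have D0: "D > 0" using pq by (simp add: D_def)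
  have uD: "u * D = w * (1 - w)" using h(1) unfolding w_def D_def by algebra
  hence w1: "w < 1" using u D0 w0
    by (metis diff_gt_0_iff_gt mult_pos_pos zero_less_mult_pos)
  have \<rho>2: "\<rho> + 2 \<noteq> 0" using h(3) w0 by auto
  have gap: "D = kite_gap \<rho> w" 
  proof -
    have "1 - D = 2 * w / (\<rho> + 2)" using h(3) \<rho>2 by (simp add: eq_divide_eq mult.commute)
    thus ?thesis unfolding kite_gap_def by simp
  qed
  show "(p - q)\<^sup>2 = kite_gap \<rho> w" using gap D_def by simp
  show sum: "(u + p\<^sup>2) + (u + q\<^sup>2) = kite_gap \<rho> w + 2 * w"
  proof -
    have "(u + p\<^sup>2) + (u + q\<^sup>2) = D + 2 * (u + p * q)"
      unfolding D_def by (simp add: power2_eq_square algebra_simps)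
    thus ?thesis using gap h(1) by simp
  qed
  show "4 * u = 4 * w * (1 - w) / kite_gap \<rho> w"
    unfolding gap[symmetric] using uD D0 by (simp add: field_simps)
  have "D * (p * q) = w * (D - 1 + w)" using uD h(1) by algebra
  hence "D * (p * q) * (\<rho> + 2) = \<rho> * w\<^sup>2" using h(3) by algebra
  thus "p * q * ((\<rho> + 2) * kite_gap \<rho> w) = \<rho> * w\<^sup>2" using gap by algebra
  have "(kite_gap \<rho> w + 2 * w)\<^sup>2 - 4 * w = ((p - q) * (p + q))\<^sup>2"
    unfolding sum[symmetric] unfolding w_def by algebra
  also have "\<dots> > 0" using pq strict by simp
  finally show "w \<in> kite_roots \<rho>"
    unfolding kite_roots_def using \<rho>2 w0 w1 D0 gap h(2) kite_gap_poly[of \<rho> w] by auto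
qed

text \<open>
  From a root back to a kite: \<open>w\<close> fixes \<open>u\<close>, \<open>p - q\<close> and \<open>p + q\<close> up to signs. Taking both
  \<open>p - q\<close> and \<open>p + q\<close> positive makes \<open>p\<close> the axis vortex farther from the off-axis pair; the other sign
  choices are obtained by reflection and by exchanging the two axis vortices.
\<close>

lemma kite_roots_equations:
  assumes w: "w \<in> kite_roots \<rho>"
  obtains u p q where "u > 0" "p \<noteq> q" "p + q \<noteq> 0" "kite_equations \<rho> u p q"
    "(u + p\<^sup>2) * (u + q\<^sup>2) = w" "u + q\<^sup>2 < u + p\<^sup>2"
proof -
  define D where "D = kite_gap \<rho> w"
  have \<rho>: "\<rho> + 2 \<noteq> 0" and w0: "w > 0" and w1: "w < 1" and poly: "kite_poly \<rho> w = 0" and D0: "D > 0"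
    and disc: "(D + 2 * w)\<^sup>2 - 4 * w > 0"
    using w by (auto simp: kite_roots_def D_def)
  define u where "u = w * (1 - w) / D"
  \<comment> \<open>the prospective value of \<open>p + q\<close>: \<open>P - Q = (p - q) * (p + q)\<close> with \<open>p - q = sqrt D\<close>\<close>
  define r where "r = sqrt ((D + 2 * w)\<^sup>2 - 4 * w) / sqrt D"
  define p q where "p = (r + sqrt D) / 2" and "q = (r - sqrt D) / 2"
  have u0: "u > 0" using w0 w1 D0 by (simp add: u_def)
  have r0: "r > 0" using disc D0 by (simp add: r_def)
  have s0: "sqrt D > 0" using D0 by simp
  have pmq: "p - q = sqrt D" and ppq: "p + q = r" by (simp_all add: p_def q_def field_simps)
  have D: "(p - q)\<^sup>2 = D" using D0 pmq by simp
  have r2: "r\<^sup>2 * D = (D + 2 * w)\<^sup>2 - 4 * w" using disc D0 by (simp add: r_def power_divide)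
  have uD: "u * D = w * (1 - w)" using D0 by (simp add: u_def)
  have "4 * (p * q) = r\<^sup>2 - D"
    unfolding D[symmetric] ppq[symmetric] by (simp add: power2_eq_square algebra_simps)
  hence "4 * (u + p * q) * D = 4 * w * D" using r2 uD by algebra
  hence upq: "u + p * q = w" using D0 by simp
  have "(u + p\<^sup>2) * (u + q\<^sup>2) = (u + p * q)\<^sup>2 + u * (p - q)\<^sup>2" by algebra
  also have "\<dots> = w" unfolding upq D uD by (simp add: power2_eq_square algebra_simps)
  finally have prod: "(u + p\<^sup>2) * (u + q\<^sup>2) = w" .
  have "p \<noteq> q" "p + q \<noteq> 0" using s0 r0 pmq ppq by auto
  moreover have "kite_equations \<rho> u p q"
    unfolding kite_equations_iff[OF u0 calculation] prod D
  proof (intro conjI)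
    show "u + p * q = w" by fact
    show "D * (1 + 2 * \<rho> * (1 - w)) = 4 * w * (1 - w)"
      using kite_gap_poly[of \<rho> w] \<rho> poly D_def by auto
    show "(\<rho> + 2) * (1 - D) = 2 * w" using \<rho> by (simp add: D_def kite_gap_def)
  qed
  moreover have "u + q\<^sup>2 < u + p\<^sup>2"
  proof -
    have "p\<^sup>2 - q\<^sup>2 = r * sqrt D"
      unfolding pmq[symmetric] ppq[symmetric] by (simp add: power2_eq_square algebra_simps)
    also have "\<dots> > 0" using r0 s0 by simp
    finally show ?thesis by simp
  qed
  ultimately show ?thesis using u0 prod that by blast
qed

text \<open>
  On a root, \<open>4 * w * (1 - w)\<close> may be replaced by \<open>D * (1 + 2 * \<rho> * (1 - w))\<close>; then \<open>D\<close> splits off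
  from the reality condition, which becomes linear in \<open>w\<close> and can be compared with the position of the
  roots.
\<close>

lemma kite_roots_iff:
  assumes "\<rho> + 2 \<noteq> 0"
  shows "w \<in> kite_roots \<rho> \<longleftrightarrow> 0 < w \<and> w < 1 \<and> kite_poly \<rho> w = 0 \<and> 0 < kite_gap \<rho> w \<and>
    \<rho> < w * ((\<rho> + 1) * (\<rho> + 3) / (\<rho> + 2))"
proof -
  have "4 * w < (kite_gap \<rho> w + 2 * w)\<^sup>2 \<longleftrightarrow> \<rho> < w * ((\<rho> + 1) * (\<rho> + 3) / (\<rho> + 2))"
    if poly: "kite_poly \<rho> w = 0" and gap: "0 < kite_gap \<rho> w"
  proof -
    have "(kite_gap \<rho> w + 2 * w)\<^sup>2 - 4 * w
        = (kite_gap \<rho> w)\<^sup>2 + 4 * w * kite_gap \<rho> w - kite_gap \<rho> w * (1 + 2 * \<rho> * (1 - w))"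
      using kite_gap_poly[of \<rho> w] poly assms by algebra
    also have "\<dots> = kite_gap \<rho> w * (kite_gap \<rho> w + 4 * w - 1 - 2 * \<rho> * (1 - w))" by algebra
    also have "kite_gap \<rho> w + 4 * w - 1 - 2 * \<rho> * (1 - w)
        = 2 * (w * ((\<rho> + 1) * (\<rho> + 3) / (\<rho> + 2)) - \<rho>)"
      using assms unfolding kite_gap_def by (simp add: field_simps power2_eq_square)
    finally have "0 < (kite_gap \<rho> w + 2 * w)\<^sup>2 - 4 * w \<longleftrightarrow>
        0 < 2 * (w * ((\<rho> + 1) * (\<rho> + 3) / (\<rho> + 2)) - \<rho>)"
      using gap by (simp only: zero_less_mult_iff) auto
    moreover have "y < z \<longleftrightarrow> 0 < z - y" "y < z \<longleftrightarrow> 0 < 2 * (z - y)" for y z :: real by auto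
    ultimately show ?thesis by blast
  qed
  thus ?thesis using assms unfolding kite_roots_def by auto
qed

section \<open>The number of admissible roots\<close>

lemma kite_poly_square:
  "8 * (\<rho> + 1) * kite_poly \<rho> w =
     (8 * (\<rho> + 1) * (w - (\<rho> + 5) / 8))\<^sup>2 - (\<rho> + 1) * (\<rho> - 1) * (\<rho>\<^sup>2 - 4 * \<rho> - 9)"
  unfolding kite_poly_def by (simp add: power2_eq_square field_simps)

text \<open>
  For \<open>\<rho> \<ge> 3\<close> all coefficients of \<open>kite_poly\<close> expanded in \<open>1 - w\<close> are nonnegative; for
  \<open>1 < \<rho> < 3\<close> the discriminant is negative.
\<close>

lemma kite_roots_gt_1:
  assumes "\<rho> > 1" shows "kite_roots \<rho> = {}"
proof -
  have "kite_poly \<rho> w > 0" if "w < 1" for w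
  proof (cases "\<rho> \<ge> 3")
    case True
    have "kite_poly \<rho> w = 8 * (\<rho> + 1) * (1 - w)\<^sup>2 + 2 * (\<rho> + 1) * (\<rho> - 3) * (1 - w) + \<rho>"
      unfolding kite_poly_def by (simp add: power2_eq_square algebra_simps)
    moreover have "8 * (\<rho> + 1) * (1 - w)\<^sup>2 \<ge> 0" "2 * (\<rho> + 1) * (\<rho> - 3) * (1 - w) \<ge> 0"
      using True that by simp_all
    ultimately show ?thesis using True by linarith
  next
    case False
    have "\<rho>\<^sup>2 - 4 * \<rho> - 9 = (\<rho> - 2)\<^sup>2 - 13" by (simp add: power2_eq_square algebra_simps)
    moreover have "(\<rho> - 2)\<^sup>2 \<le> 1\<^sup>2" by (rule power2_le_iff_abs_le[THEN iffD2]) (use assms False in auto)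
    ultimately have "\<rho>\<^sup>2 - 4 * \<rho> - 9 < 0" by simp
    hence "(\<rho> + 1) * (\<rho> - 1) * (\<rho>\<^sup>2 - 4 * \<rho> - 9) < 0"
      using assms by (intro mult_pos_neg) auto
    hence "8 * (\<rho> + 1) * kite_poly \<rho> w > 0" unfolding kite_poly_square
      using zero_le_power2[of "8 * (\<rho> + 1) * (w - (\<rho> + 5) / 8)"] by linarith
    thus ?thesis using assms by (simp add: zero_less_mult_iff)
  qed
  thus ?thesis unfolding kite_roots_def by fastforce
qed

text \<open>
  The degenerate case: \<open>kite_poly 1 w = (4 * w - 3)\<^sup>2\<close>.
\<close>

lemma kite_roots_1: "kite_roots 1 = {3/4}"
proof -
  have "kite_poly 1 w = 0 \<longleftrightarrow> w = 3/4" for w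
  proof -
    have "kite_poly 1 w = (4 * w - 3)\<^sup>2" unfolding kite_poly_def by (simp add: power2_eq_square algebra_simps)
    thus ?thesis by auto
  qed
  note root = this
  have "w \<in> kite_roots 1 \<longleftrightarrow> w = 3/4" for w
  proof (cases "w = 3/4")
    case True
    have "kite_gap 1 (3/4) > 0" by (simp add: kite_gap_def)
    thus ?thesis unfolding True using kite_roots_iff[of 1 "3/4"] root[of "3/4"] by simp
  next
    case False
    thus ?thesis using root[of w] by (simp add: kite_roots_def)
  qed
  thus ?thesis by blast
qed

text \<open>
  The vertex \<open>v\<close> of the parabola lies between \<open>w0\<close>, the bound below which the kite would not be real,
  and 1. The discriminant is positive, and so is the parabola at \<open>w0\<close> and at 1. Hence both roots
  \<open>v \<plusminus> t\<close> lie strictly between \<open>w0\<close> and 1.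
\<close>

lemma card_kite_roots_0_1:
  assumes "0 < \<rho>" "\<rho> < 1" shows "card (kite_roots \<rho>) = 2"
proof -
  define v where "v = (\<rho> + 5) / 8"
  define d where "d = (\<rho> + 1) * (\<rho> - 1) * (\<rho>\<^sup>2 - 4 * \<rho> - 9)"
  define t where "t = sqrt d / (8 * (\<rho> + 1))"
  define w0 where "w0 = \<rho> * (\<rho> + 2) / ((\<rho> + 1) * (\<rho> + 3))"
  have "\<rho>\<^sup>2 < 1" using assms by (simp add: power_less_one_iff)
  hence "(\<rho> - 1) * (\<rho>\<^sup>2 - 4 * \<rho> - 9) > 0"
    using assms by (intro mult_neg_neg) linarith+
  hence d: "d > 0" unfolding d_def using assms by (simp add: mult.assoc)
  have t: "t > 0" using d assms by (simp add: t_def)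
  have dt: "d = (8 * (\<rho> + 1) * t)\<^sup>2" using d assms by (simp add: t_def)
  have sq: "kite_poly \<rho> w = 8 * (\<rho> + 1) * ((w - v)\<^sup>2 - t\<^sup>2)" for w
  proof -
    have "8 * (\<rho> + 1) * kite_poly \<rho> w = 8 * (\<rho> + 1) * (8 * (\<rho> + 1) * ((w - v)\<^sup>2 - t\<^sup>2))"
      unfolding kite_poly_square v_def[symmetric] d_def[symmetric] dt
      by (simp add: power2_eq_square algebra_simps)
    thus ?thesis using assms by simp
  qed
  have root: "kite_poly \<rho> w = 0 \<longleftrightarrow> w = v - t \<or> w = v + t" for w
    using assms unfolding sq by (auto simp: power2_eq_iff)
  have pos: "t < \<bar>w - v\<bar>" if "kite_poly \<rho> w > 0" for w
  proof -
    have "(w - v)\<^sup>2 - t\<^sup>2 > 0" using that assms unfolding sq by (simp add: zero_less_mult_iff)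
    hence "t\<^sup>2 < \<bar>w - v\<bar>\<^sup>2" by simp
    thus ?thesis by (rule power2_less_imp_less) simp
  qed
  have "kite_poly \<rho> 1 = \<rho>" unfolding kite_poly_def by (simp add: power2_eq_square algebra_simps)
  hence 1: "v + t < 1" using pos[of 1] assms by (simp add: v_def)
  have "kite_poly \<rho> w0 * ((\<rho> + 1) * (\<rho> + 3)\<^sup>2) = (\<rho> + 2) * (5 * \<rho>^3 + 7 * \<rho>\<^sup>2 + 3 * \<rho> + 9)"
  proof -
    define M N where "M = (\<rho> + 1) * (\<rho> + 3)" and "N = \<rho> * (\<rho> + 2)"
    have MN: "w0 * M = N" using assms by (simp add: w0_def M_def N_def)
    have "kite_poly \<rho> w0 * ((\<rho> + 1) * (\<rho> + 3)\<^sup>2) = 8 * (w0 * M)\<^sup>2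
        - 2 * (\<rho> + 1) * (\<rho> + 5) * (\<rho> + 3) * (w0 * M) + (\<rho> + 2) * (2 * \<rho> + 1) * M * (\<rho> + 3)"
      unfolding kite_poly_def M_def by (simp add: power2_eq_square algebra_simps)
    also have "\<dots> = (\<rho> + 2) * (5 * \<rho>^3 + 7 * \<rho>\<^sup>2 + 3 * \<rho> + 9)"
      unfolding MN unfolding M_def N_def by (simp add: power2_eq_square power3_eq_cube algebra_simps)
    finally show ?thesis .
  qed
  also have "\<dots> > 0" using assms by (intro mult_pos_pos add_pos_pos) auto
  finally have "kite_poly \<rho> w0 * ((\<rho> + 1) * (\<rho> + 3)\<^sup>2) > 0" .
  moreover have "(\<rho> + 1) * (\<rho> + 3)\<^sup>2 > 0" using assms by simp
  ultimately have "kite_poly \<rho> w0 > 0" by (metis zero_less_mult_pos2)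
  hence "t < \<bar>w0 - v\<bar>" by (rule pos)
  moreover have "w0 < v"
  proof -
    have v8: "v * ((\<rho> + 1) * (\<rho> + 3)) * 8 = \<rho>^3 + 9 * \<rho>\<^sup>2 + 23 * \<rho> + 15"
      unfolding v_def by (simp add: power2_eq_square power3_eq_cube field_simps)
    have cube: "\<rho>^3 > 0" using assms by simp
    have "\<rho> * (\<rho> + 2) < v * ((\<rho> + 1) * (\<rho> + 3))"
    proof -
      have "8 * (\<rho> * (\<rho> + 2)) = 8 * \<rho>\<^sup>2 + 16 * \<rho>" by (simp add: power2_eq_square algebra_simps)
      moreover have "\<rho>\<^sup>2 \<ge> 0" by simp
      ultimately show ?thesis using v8 cube assms by linarith
    qed
    thus ?thesis unfolding w0_def using assms by (simp add: pos_divide_less_eq)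
  qed
  ultimately have 2: "w0 < v - t" by linarith
  have w00: "w0 > 0" using assms by (simp add: w0_def)
  have "w \<in> kite_roots \<rho>" if w: "w0 < w" "w < 1" "kite_poly \<rho> w = 0" for w
  proof -
    have "2 * w < \<rho> + 2" using w assms by simp
    hence "kite_gap \<rho> w > 0" using assms by (simp add: kite_gap_def)
    moreover have "\<rho> = w0 * ((\<rho> + 1) * (\<rho> + 3) / (\<rho> + 2))" using assms by (simp add: w0_def)
    hence "\<rho> < w * ((\<rho> + 1) * (\<rho> + 3) / (\<rho> + 2))"
      using mult_strict_right_mono[OF w(1), of "(\<rho> + 1) * (\<rho> + 3) / (\<rho> + 2)"] assms by simp
    ultimately show ?thesis using kite_roots_iff[of \<rho> w] w w00 assms by auto
  qed
  hence "{v - t, v + t} \<subseteq> kite_roots \<rho>" using root 1 2 t by simp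
  moreover have "kite_roots \<rho> \<subseteq> {v - t, v + t}" using root by (auto simp: kite_roots_def)
  ultimately have "kite_roots \<rho> = {v - t, v + t}" by blast
  thus ?thesis using t by simp
qed

text \<open>
  A second root in the interval would give \<open>c = a * z * w\<close> and \<open>a + b + c = a * (1 - z) * (1 - w)\<close> the
  same sign. The sign of \<open>a\<close> is left open because the leading coefficient of \<open>kite_poly\<close> changes
  sign at \<open>\<rho> = -1\<close>.
\<close>

lemma quadratic_one_root_in_unit_interval:
  fixes a b c :: real
  assumes "c > 0" "a + b + c < 0"
  shows "card {w. 0 < w \<and> w < 1 \<and> a * w\<^sup>2 + b * w + c = 0} = 1"
proof -
  let ?f = "\<lambda>w. a * w\<^sup>2 + b * w + c"
  have "\<exists>w\<ge>0. w \<le> 1 \<and> ?f w = 0"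
    by (rule IVT2) (use assms in \<open>auto intro!: continuous_intros\<close>)
  then obtain w where w: "0 \<le> w" "w \<le> 1" "?f w = 0" by blast
  have "w \<noteq> 0" "w \<noteq> 1" using w(3) assms by auto
  have "z = w" if z: "0 < z" "z < 1" "?f z = 0" for z
  proof (rule ccontr)
    assume "z \<noteq> w"
    have "(z - w) * (a * (z + w) + b) = ?f z - ?f w"
      by (simp add: power2_eq_square algebra_simps)
    hence "(z - w) * (a * (z + w) + b) = 0" using w(3) z(3) by simp
    hence b: "b = - a * (z + w)" using \<open>z \<noteq> w\<close> by simp
    have "c = - (a * z\<^sup>2) - b * z" using z(3) by simp
    hence c: "c = a * (z * w)" unfolding b by (simp add: power2_eq_square algebra_simps)
    have "z * w > 0" using z w \<open>w \<noteq> 0\<close> by simp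
    hence "a > 0" using c assms(1) by (metis zero_less_mult_pos2)
    hence "a * ((1 - z) * (1 - w)) \<ge> 0" using z w by simp
    moreover have "a + b + c = a * ((1 - z) * (1 - w))" unfolding b c by (simp add: algebra_simps)
    ultimately show False using assms(2) by simp
  qed
  hence "{w. 0 < w \<and> w < 1 \<and> ?f w = 0} = {w}" using w \<open>w \<noteq> 0\<close> \<open>w \<noteq> 1\<close> by force
  thus ?thesis by simp
qed

text \<open>
  In both ranges \<open>kite_poly\<close> is positive at 0 and negative at 1, and the remaining conditions on a
  root in \<open>(0, 1)\<close> hold automatically.
\<close>

lemma card_kite_roots_one:
  assumes "-1/2 < \<rho> \<and> \<rho> < 0 \<or> \<rho> < -2" shows "card (kite_roots \<rho>) = 1"
proof -
  have "kite_poly \<rho> w = (8 * (\<rho> + 1)) * w\<^sup>2 + (- 2 * (\<rho> + 1) * (\<rho> + 5)) * w + (\<rho> + 2) * (2 * \<rho> + 1)" for w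
    unfolding kite_poly_def by (simp add: algebra_simps)
  moreover have "(\<rho> + 2) * (2 * \<rho> + 1) > 0" using assms by (auto intro: mult_neg_neg)
  moreover have "8 * (\<rho> + 1) + (- 2 * (\<rho> + 1) * (\<rho> + 5)) + (\<rho> + 2) * (2 * \<rho> + 1) < 0"
    using assms by (auto simp: algebra_simps)
  ultimately have "card {w. 0 < w \<and> w < 1 \<and> kite_poly \<rho> w = 0} = 1"
    using quadratic_one_root_in_unit_interval by presburger
  moreover have "kite_roots \<rho> = {w. 0 < w \<and> w < 1 \<and> kite_poly \<rho> w = 0}"
  proof -
    have "w \<in> kite_roots \<rho>" if w: "0 < w" "w < 1" "kite_poly \<rho> w = 0" for w
      using assms
    proof
      assume \<rho>: "-1/2 < \<rho> \<and> \<rho> < 0"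
      have "(- 2 * \<rho>) * (1 - w) < 1 * 1" using \<rho> w by (intro mult_strict_mono) auto
      hence "1 + 2 * \<rho> * (1 - w) > 0" by simp
      moreover have "kite_gap \<rho> w * (1 + 2 * \<rho> * (1 - w)) = 4 * w * (1 - w)"
        using kite_gap_poly[of \<rho> w] w \<rho> by auto
      moreover have "\<dots> > 0" using w by simp
      ultimately have "kite_gap \<rho> w > 0" by (metis zero_less_mult_pos2)
      moreover have "w * ((\<rho> + 1) * (\<rho> + 3) / (\<rho> + 2)) > 0" using w \<rho> by simp
      hence "\<rho> < w * ((\<rho> + 1) * (\<rho> + 3) / (\<rho> + 2))" using \<rho> by linarith
      ultimately show ?thesis using kite_roots_iff[of \<rho> w] w \<rho> by auto
    next
      assume \<rho>: "\<rho> < -2"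
      have "w / (\<rho> + 2) < 0" using w \<rho> by (simp add: divide_pos_neg)
      hence "kite_gap \<rho> w > 0" by (simp add: kite_gap_def)
      moreover have "w * ((\<rho> + 1) * (\<rho> + 3)) < \<rho> * (\<rho> + 2)"
      proof (cases "\<rho> \<le> -3")
        case True
        hence "(\<rho> + 1) * (\<rho> + 3) \<ge> 0" by (intro mult_nonpos_nonpos) auto
        hence "w * ((\<rho> + 1) * (\<rho> + 3)) \<le> 1 * ((\<rho> + 1) * (\<rho> + 3))" 
          using w by (intro mult_right_mono) auto
        also have "\<dots> < \<rho> * (\<rho> + 2)" using \<rho> by (simp add: algebra_simps)
        finally show ?thesis .
      next
        case False
        hence "(\<rho> + 1) * (\<rho> + 3) < 0" using \<rho> by (intro mult_neg_pos) auto
        hence "w * ((\<rho> + 1) * (\<rho> + 3)) < 0" using w by (intro mult_pos_neg[of w]) auto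
        also have "0 < \<rho> * (\<rho> + 2)" using \<rho> by (intro mult_neg_neg) auto
        finally show ?thesis .
      qed
      hence "\<rho> < w * ((\<rho> + 1) * (\<rho> + 3)) / (\<rho> + 2)" using \<rho> by (simp add: neg_less_divide_eq)
      ultimately show ?thesis using kite_roots_iff[of \<rho> w] w \<rho> by auto
    qed
    thus ?thesis by (auto simp: kite_roots_def)
  qed
  ultimately show ?thesis by simp
qed

text \<open>
  For \<open>\<rho> > -1\<close> the parabola opens upwards and is at most 0 at both ends of \<open>[0, 1]\<close>. For
  \<open>\<rho> \<le> -1\<close> the polynomial may well have roots in \<open>(0, 1)\<close>, but positivity of \<open>D\<close> requires
  \<open>w < (\<rho> + 2) / 2 \<le> 1/2\<close> by the formula for \<open>D\<close>, and \<open>1 + 2 * \<rho> * (1 - w) > 0\<close>, hence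
  \<open>w > 1/2\<close>, by the equation that defines the roots.
\<close>

lemma kite_roots_empty:
  assumes "-2 \<le> \<rho>" "\<rho> \<le> -1/2" shows "kite_roots \<rho> = {}"
proof (rule ccontr)
  assume "kite_roots \<rho> \<noteq> {}"
  then obtain w where "w \<in> kite_roots \<rho>" by blast
  hence \<rho>: "\<rho> \<noteq> -2" and w: "0 < w" "w < 1" and poly: "kite_poly \<rho> w = 0" and gap: "kite_gap \<rho> w > 0"
    by (auto simp: kite_roots_def)
  show False
  proof (cases "\<rho> > -1")
    case True
    have "kite_poly \<rho> w = - 8 * (\<rho> + 1) * (w * (1 - w)) + (1 - w) * ((\<rho> + 2) * (2 * \<rho> + 1)) + w * \<rho>"
      unfolding kite_poly_def by (simp add: power2_eq_square algebra_simps)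
    moreover have "(\<rho> + 1) * (w * (1 - w)) > 0" using True w by simp
    moreover have "(\<rho> + 2) * (2 * \<rho> + 1) \<le> 0" using True assms by (intro mult_nonneg_nonpos) auto
    hence "(1 - w) * ((\<rho> + 2) * (2 * \<rho> + 1)) \<le> 0" using w by (intro mult_nonneg_nonpos[of "1 - w"]) auto
    moreover have "w * \<rho> < 0" using w assms by (intro mult_pos_neg) auto
    ultimately show False using poly by linarith
  next
    case False
    have "2 * w < \<rho> + 2" using gap \<rho> assms by (simp add: kite_gap_def field_simps split: if_splits)
    have "kite_gap \<rho> w * (1 + 2 * \<rho> * (1 - w)) = 4 * w * (1 - w)"
      using kite_gap_poly[of \<rho> w] poly \<rho> by auto
    moreover have "\<dots> > 0" using w by simp
    ultimately have "1 + 2 * \<rho> * (1 - w) > 0" using gap by (metis zero_less_mult_pos)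
    moreover have "1 * (1 - w) \<le> (- \<rho>) * (1 - w)" using False w by (intro mult_right_mono) auto
    ultimately show False using \<open>2 * w < \<rho> + 2\<close> False by simp
  qed
qed

section \<open>Equilibrium configurations in the plane\<close>

text \<open>
  The vector form of the equations with \<open>\<lambda>' = -1\<close>; the unsymmetrized Albouy-Chenciner equations are its
  projections onto the differences of the positions.
\<close>

definition balanced :: "(4 \<Rightarrow> real) \<Rightarrow> (4 \<Rightarrow> real^2) \<Rightarrow> bool" where
  "balanced \<Gamma> x \<longleftrightarrow>
     (\<forall>i. (\<Sum>k\<in>UNIV. (\<Gamma> k * S (-1) (squared_distances x) i k) *\<^sub>R (x k - x i)) = 0)"

lemma squared_distances_inner:
  "squared_distances x i j = (x i - x j) \<bullet> (x i - x j)"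
  by (simp add: squared_distances_def dist_norm power2_norm_eq_inner)

text \<open>
  The law of cosines, \<open>s j k - s i k - s i j = - 2 * ((x k - x i) \<bullet> (x j - x i))\<close>.
\<close>

lemma unsym_as_projection:
  fixes x :: "4 \<Rightarrow> real^2"
  defines "s \<equiv> squared_distances x"
  shows "(\<Sum>k\<in>UNIV. \<Gamma> k * S lam s i k * (s j k - s i k - s i j)) =
    - 2 * ((\<Sum>k\<in>UNIV. (\<Gamma> k * S lam s i k) *\<^sub>R (x k - x i)) \<bullet> (x j - x i))"
proof -
  have "s j k - s i k - s i j = - 2 * ((x k - x i) \<bullet> (x j - x i))" for k
    unfolding s_def squared_distances_inner
    by (simp add: inner_diff_left inner_diff_right inner_commute)
  thus ?thesis
    unfolding inner_sum_left sum_distrib_left by (intro sum.cong) simp_all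
qed

lemma balanced_imp_unsym:
  "balanced \<Gamma> x \<Longrightarrow> unsym_albouy_chenciner (-1) \<Gamma> (squared_distances x)"
  unfolding unsym_albouy_chenciner_def balanced_def unsym_as_projection by simp

lemma unsym_imp_sym:
  assumes "unsym_albouy_chenciner lam \<Gamma> s" and "\<And>i j. s i j = s j i"
  shows "albouy_chenciner lam \<Gamma> s"
  unfolding albouy_chenciner_def
proof (intro allI impI)
  fix i j :: 4 assume "i \<noteq> j"
  hence "(\<Sum>k\<in>UNIV. \<Gamma> k * S lam s i k * (s j k - s i k - s i j)) = 0"
    "(\<Sum>k\<in>UNIV. \<Gamma> k * S lam s j k * (s i k - s j k - s j i)) = 0"
    using assms(1) unfolding unsym_albouy_chenciner_def by simp_all
  thus "(\<Sum>k\<in>UNIV. \<Gamma> k * (S lam s i k * (s j k - s i k - s i j) + S lam s j k * (s i k - s j k - s i j))) = 0"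
    unfolding assms(2)[of j i] by (simp add: distrib_left sum.distrib mult.assoc)
qed

lemma UNIV4_distinct:
  assumes "{i, j, k, l} = (UNIV :: 4 set)"
  shows "i \<noteq> j" "i \<noteq> k" "i \<noteq> l" "j \<noteq> k" "j \<noteq> l" "k \<noteq> l"
proof -
  have "card (set [i, j, k, l]) = 4" using assms by simp
  hence "distinct [i, j, k, l]" by (intro card_distinct) simp
  thus "i \<noteq> j" "i \<noteq> k" "i \<noteq> l" "j \<noteq> k" "j \<noteq> l" "k \<noteq> l" by auto
qed

text \<open>
  The interactions \<open>\<Gamma> i * \<Gamma> j / s i j *\<^sub>R (x j - x i)\<close> cancel in pairs, so \<open>c\<close> is the centre of
  vorticity. This turns \<open>x i - c\<close> into a combination of the differences \<open>x j - x i\<close>, with which the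
  equations read \<open>\<Sum>j. \<Gamma> j * (1 / s i j + \<lambda>') *\<^sub>R (x j - x i) = 0\<close>. Scaling lengths by
  \<open>sqrt (-\<lambda>')\<close> normalizes \<open>\<lambda>'\<close> to -1.
\<close>

lemma relative_equilibrium_imp_balanced:
  assumes re: "relative_equilibrium \<Gamma> lam c x" and total: "(\<Sum>i\<in>UNIV. \<Gamma> i) \<noteq> 0"
    and neg: "lambda_prime \<Gamma> lam < 0"
  defines "b \<equiv> sqrt (- lambda_prime \<Gamma> lam)"
  shows "balanced \<Gamma> (\<lambda>i. b *\<^sub>R x i)"
proof -
  define G where "G = (\<Sum>i\<in>UNIV. \<Gamma> i)"
  define s where "s = squared_distances x"
  have b: "b > 0" "b\<^sup>2 = - lambda_prime \<Gamma> lam" using neg by (simp_all add: b_def)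
  have lam: "lam = b\<^sup>2 * G" using total by (simp add: b(2) lambda_prime_def G_def)
  have lam0: "lam \<noteq> 0" using re by (simp add: relative_equilibrium_def)
  have eq: "- lam *\<^sub>R (x i - c) = (\<Sum>j\<in>UNIV. (\<Gamma> j / s i j) *\<^sub>R (x j - x i))" for i
    using re by (simp add: relative_equilibrium_def s_def squared_distances_def sum_diff1)
  have sym: "s i j = s j i" for i j by (simp add: s_def squared_distances_def dist_commute)
  have "(\<Sum>i\<in>UNIV. \<Gamma> i *\<^sub>R (- lam *\<^sub>R (x i - c))) = 0"
  proof -
    define T where "T = (\<Sum>i\<in>UNIV. \<Sum>j\<in>UNIV. (\<Gamma> i * \<Gamma> j / s i j) *\<^sub>R (x j - x i))"
    have "T = (\<Sum>i\<in>UNIV. \<Sum>j\<in>UNIV. (\<Gamma> j * \<Gamma> i / s j i) *\<^sub>R (x i - x j))"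
      unfolding T_def by (rule sum.swap)
    also have "\<dots> = (\<Sum>i\<in>UNIV. \<Sum>j\<in>UNIV. - ((\<Gamma> i * \<Gamma> j / s i j) *\<^sub>R (x j - x i)))"
    proof (intro sum.cong refl)
      fix i j
      have "\<Gamma> j * \<Gamma> i / s j i = \<Gamma> i * \<Gamma> j / s i j" using sym[of i j] by simp
      thus "(\<Gamma> j * \<Gamma> i / s j i) *\<^sub>R (x i - x j) = - ((\<Gamma> i * \<Gamma> j / s i j) *\<^sub>R (x j - x i))"
        by (metis minus_diff_eq scaleR_minus_right)
    qed
    also have "\<dots> = - T" unfolding T_def sum_negf ..
    finally have "2 *\<^sub>R T = 0" by (simp add: scaleR_2 eq_neg_iff_add_eq_0)
    hence "T = 0" by simp
    thus ?thesis unfolding eq T_def by (simp add: scaleR_sum_right)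
  qed
  hence "lam *\<^sub>R (\<Sum>i\<in>UNIV. \<Gamma> i *\<^sub>R (x i - c)) = 0"
    by (simp add: scaleR_sum_right mult.commute sum_negf)
  hence "(\<Sum>j\<in>UNIV. \<Gamma> j *\<^sub>R (x j - c)) = 0" using lam0 by simp
  hence cm: "(\<Sum>j\<in>UNIV. \<Gamma> j *\<^sub>R (x j - x i)) = - G *\<^sub>R (x i - c)" for i
  proof -
    have "(\<Sum>j\<in>UNIV. \<Gamma> j *\<^sub>R (x j - x i)) = (\<Sum>j\<in>UNIV. \<Gamma> j *\<^sub>R (x j - c) - \<Gamma> j *\<^sub>R (x i - c))"
      by (intro sum.cong refl) (simp add: scaleR_diff_right)
    also have "\<dots> = - (\<Sum>j\<in>UNIV. \<Gamma> j *\<^sub>R (x i - c))"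
      unfolding sum_subtractf \<open>(\<Sum>j\<in>UNIV. \<Gamma> j *\<^sub>R (x j - c)) = 0\<close> by simp
    also have "\<dots> = - G *\<^sub>R (x i - c)" unfolding scaleR_sum_left[symmetric] G_def by simp
    finally show ?thesis .
  qed
  have "(\<Sum>k\<in>UNIV. (\<Gamma> k * S (-1) (squared_distances (\<lambda>i. b *\<^sub>R x i)) i k) *\<^sub>R (b *\<^sub>R x k - b *\<^sub>R x i)) = 0" for i
  proof -
    have "squared_distances (\<lambda>i. b *\<^sub>R x i) i k = b\<^sup>2 * s i k" for k
      unfolding squared_distances_inner s_def
      by (simp add: scaleR_diff_right[symmetric] power2_eq_square mult.assoc)
    note scaled = this
    have "(\<Gamma> k * S (-1) (squared_distances (\<lambda>i. b *\<^sub>R x i)) i k) *\<^sub>R (b *\<^sub>R x k - b *\<^sub>R x i)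
        = (1 / b) *\<^sub>R ((\<Gamma> k / s i k) *\<^sub>R (x k - x i)) - b *\<^sub>R (\<Gamma> k *\<^sub>R (x k - x i))" for k
    proof (cases "i = k")
      case False
      have "\<Gamma> k * (1 / (b\<^sup>2 * s i k) - 1) * b = 1 / b * (\<Gamma> k / s i k) - b * \<Gamma> k"
        using b(1) by (simp add: power2_eq_square right_diff_distrib left_diff_distrib)
      thus ?thesis using False
        by (simp add: S_def scaled scaleR_diff_right[symmetric] scaleR_diff_left[symmetric])
    qed simp
    hence "(\<Sum>k\<in>UNIV. (\<Gamma> k * S (-1) (squared_distances (\<lambda>i. b *\<^sub>R x i)) i k) *\<^sub>R (b *\<^sub>R x k - b *\<^sub>R x i))
        = (\<Sum>k\<in>UNIV. (1 / b) *\<^sub>R ((\<Gamma> k / s i k) *\<^sub>R (x k - x i)) - b *\<^sub>R (\<Gamma> k *\<^sub>R (x k - x i)))"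
      by (intro sum.cong refl)
    also have "\<dots> = (1 / b) *\<^sub>R (\<Sum>k\<in>UNIV. (\<Gamma> k / s i k) *\<^sub>R (x k - x i)) - b *\<^sub>R (\<Sum>k\<in>UNIV. \<Gamma> k *\<^sub>R (x k - x i))"
      by (simp only: sum_subtractf scaleR_sum_right)
    also have "\<dots> = (1 / b) *\<^sub>R (- lam *\<^sub>R (x i - c)) - b *\<^sub>R (- G *\<^sub>R (x i - c))"
      unfolding eq cm ..
    also have "\<dots> = 0" unfolding lam using b(1) by (simp add: power2_eq_square)
    finally show ?thesis .
  qed
  thus ?thesis unfolding balanced_def by blast
qed

text \<open>
  Four points of the plane are affinely dependent. If \<open>\<Sum>j. d j = 0\<close> and \<open>\<Sum>j. d j *\<^sub>R x j = 0\<close>, then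
  \<open>\<Sum>j. s i j * d j\<close> is the same number for all \<open>i\<close>, so that \<open>d\<close>, preceded by the negative of this
  number, is a kernel vector of the matrix.
\<close>

lemma cayley_menger_planar:
  fixes x :: "4 \<Rightarrow> real^2"
  assumes "inj x"
  shows "cayley_menger (squared_distances x) = 0"
proof -
  define s where "s = squared_distances x"
  have "card (range x) = 4" using assms by (simp add: card_image)
  hence "affine_dependent (range x)" by (intro affine_dependent_biggerset) simp_all
  then obtain U t where U: "sum U (range x) = 0" "U (x t) \<noteq> 0" "(\<Sum>v\<in>range x. U v *\<^sub>R v) = 0"
    by (auto simp: affine_dependent_explicit_finite)
  define d where "d = U \<circ> x"
  define h where "h = - (\<Sum>j\<in>UNIV. d j * (x j \<bullet> x j))"
  have d0: "sum d UNIV = 0" and d1: "(\<Sum>j\<in>UNIV. d j *\<^sub>R x j) = 0"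
    using U(1,3) assms by (simp_all add: d_def sum.reindex)
  have row: "h + (\<Sum>j\<in>UNIV. s i j * d j) = 0" for i
  proof -
    have "(\<Sum>j\<in>UNIV. s i j * d j) = 
      (\<Sum>j\<in>UNIV. (x i \<bullet> x i) * d j - 2 * (x i \<bullet> (d j *\<^sub>R x j)) + d j * (x j \<bullet> x j))"
      unfolding s_def squared_distances_inner
      by (intro sum.cong) (simp_all add: inner_diff_left inner_diff_right inner_commute algebra_simps)
    also have "\<dots> = (x i \<bullet> x i) * sum d UNIV - 2 * (x i \<bullet> (\<Sum>j\<in>UNIV. d j *\<^sub>R x j)) - h"
      by (simp add: sum.distrib sum_subtractf sum_distrib_left[symmetric] inner_sum_right h_def)
    finally show ?thesis by (simp add: d0 d1)
  qed
  have sym: "s i j = s j i" "s i i = 0" for i j by (simp_all add: s_def squared_distances_def dist_commute)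
  define v :: "real^5" where "v = vector [h, d 1, d 2, d 3, d 4]"
  define M :: "real^5^5" where "M = vector
     [vector [0, 1, 1, 1, 1],
      vector [1, 0, s 1 2, s 1 3, s 1 4],
      vector [1, s 1 2, 0, s 2 3, s 2 4],
      vector [1, s 1 3, s 2 3, 0, s 3 4],
      vector [1, s 1 4, s 2 4, s 3 4, 0]]"
  have U5: "UNIV = {1, 2, 3, 4, 5 :: 5}"
    by (rule card_subset_eq[symmetric]) auto
  have vec: "vector [a, b, c, f, g] $ (1 :: 5) = a" "vector [a, b, c, f, g] $ (2 :: 5) = b"
    "vector [a, b, c, f, g] $ (3 :: 5) = c" "vector [a, b, c, f, g] $ (4 :: 5) = f"
    "vector [a, b, c, f, g] $ (5 :: 5) = g" for a b c f g :: "'a :: zero"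
    by (simp_all add: vector_def)
  have sum5: "sum f (UNIV :: 5 set) = f 1 + f 2 + f 3 + f 4 + f 5" for f :: "5 \<Rightarrow> real"
    unfolding U5 by simp
  have "(M *v v) $ r = 0" for r
  proof -
    have "r = 1 \<or> r = 2 \<or> r = 3 \<or> r = 4 \<or> r = 5" using U5 by auto
    thus ?thesis
      using d0 row[of 1] row[of 2] row[of 3] row[of 4]
      by (elim disjE) (simp_all add: M_def v_def vec matrix_vector_mult_def sum5 sum_4 sym)
  qed
  hence "M *v v = 0" by (simp add: vec_eq_iff)
  moreover have "v \<noteq> 0"
  proof
    assume "v = 0"
    hence "v $ r = 0" for r by simp
    from this[of 2] this[of 3] this[of 4] this[of 5] have "\<forall>j. d j = 0"
      by (simp add: v_def vec forall_4)
    thus False using U(2) by (simp add: d_def)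
  qed
  ultimately have "\<not> invertible M"
    by (metis invertible_def matrix_left_invertible_ker)
  hence "det M = 0" by (simp add: invertible_det_nz)
  thus ?thesis unfolding cayley_menger_def M_def s_def .
qed

section \<open>Kites in a frame adapted to the axis\<close>

lemma orthonormal_basis_real2:
  fixes e n v :: "real^2"
  assumes "norm e = 1" "norm n = 1" "e \<bullet> n = 0" "v \<bullet> e = 0" "v \<bullet> n = 0"
  shows "v = 0"
proof -
  have "e \<bullet> e = 1" "n \<bullet> n = 1" using assms by (simp_all add: dot_square_norm)
  hence h: "e$1 * e$1 + e$2 * e$2 = 1" "n$1 * n$1 + n$2 * n$2 = 1" "e$1 * n$1 + e$2 * n$2 = 0"
    "v$1 * e$1 + v$2 * e$2 = 0" "v$1 * n$1 + v$2 * n$2 = 0"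
    using assms by (simp_all add: inner_vec_def sum_2)
  have "(e$1 * n$2 - e$2 * n$1)\<^sup>2 = 1" using h(1-3) by algebra
  moreover have "v$1 * (e$1 * n$2 - e$2 * n$1) = 0" "v$2 * (e$1 * n$2 - e$2 * n$1) = 0"
    using h(4,5) by algebra+
  ultimately have "v$1 = 0" "v$2 = 0" by auto
  thus ?thesis by (simp add: vec_eq_iff forall_2)
qed

lemma vec_times_2:
  fixes v :: "real^2"
  shows "2 * v = 2 *\<^sub>R v" "v * 2 = 2 *\<^sub>R v"
  by (simp_all add: vec_eq_iff)

text \<open>
  Vortices \<open>i\<close>, \<open>j\<close> symmetric with respect to the axis through \<open>c\<close> in direction \<open>n\<close>, and vortices
  \<open>k\<close>, \<open>l\<close> on it. The orthonormal frame \<open>e\<close>, \<open>n\<close> takes the place of a rigid motion to standard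
  position.
\<close>

locale kite =
  fixes x :: "4 \<Rightarrow> real^2" and i j k l :: 4 and c e n :: "real^2" and a p q :: real
  assumes labels: "{i, j, k, l} = UNIV"
    and frame: "norm e = 1" "norm n = 1" "e \<bullet> n = 0"
    and pos: "x i = c - a *\<^sub>R e" "x j = c + a *\<^sub>R e" "x k = c + p *\<^sub>R n" "x l = c + q *\<^sub>R n"
    and nondegenerate: "a > 0" "p \<noteq> q"
begin

lemmas distinct = UNIV4_distinct[OF labels]

lemma inner_frame [simp]: "e \<bullet> e = 1" "n \<bullet> n = 1" "e \<bullet> n = 0" "n \<bullet> e = 0"
  using frame by (simp_all add: dot_square_norm inner_commute)

lemma label_cases: "t = i \<or> t = j \<or> t = k \<or> t = l"
  using labels by auto

lemma sum_labels: "sum f UNIV = f i + f j + f k + f l" for f :: "4 \<Rightarrow> 'b :: comm_monoid_add"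
  unfolding labels[symmetric] using distinct by (simp add: add.assoc)

lemma swap: "kite x i j l k c e n a q p"
  using labels frame pos nondegenerate by unfold_locales auto

lemma distances:
  "squared_distances x i j = 4 * a\<^sup>2" "squared_distances x k l = (p - q)\<^sup>2"
  "squared_distances x i k = a\<^sup>2 + p\<^sup>2" "squared_distances x j k = a\<^sup>2 + p\<^sup>2"
  "squared_distances x i l = a\<^sup>2 + q\<^sup>2" "squared_distances x j l = a\<^sup>2 + q\<^sup>2"
  unfolding squared_distances_inner pos
  by (simp_all add: inner_diff_left inner_diff_right inner_add_left inner_add_right power2_eq_square algebra_simps vec_times_2)

lemma distance_sym: "squared_distances x s t = squared_distances x t s"
  by (simp add: squared_distances_def dist_commute)

lemma zero_iff: "v = 0 \<longleftrightarrow> v \<bullet> e = 0 \<and> v \<bullet> n = 0" for v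
  using orthonormal_basis_real2[OF frame] by auto

text \<open>
  The components along \<open>e\<close> and along \<open>n\<close> of the four vector equations, with common factors removed.
\<close>

lemma balanced_iff:
  fixes \<Gamma> :: "4 \<Rightarrow> real"
  defines "A \<equiv> 1 / (4 * a\<^sup>2) - 1" and "B \<equiv> 1 / (p - q)\<^sup>2 - 1"
    and "K \<equiv> 1 / (a\<^sup>2 + p\<^sup>2) - 1" and "L \<equiv> 1 / (a\<^sup>2 + q\<^sup>2) - 1"
  shows "balanced \<Gamma> x \<longleftrightarrow>
    2 * \<Gamma> j * A + \<Gamma> k * K + \<Gamma> l * L = 0 \<and> 2 * \<Gamma> i * A + \<Gamma> k * K + \<Gamma> l * L = 0 \<and>
    \<Gamma> k * (K * p) + \<Gamma> l * (L * q) = 0 \<and>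
    (\<Gamma> j - \<Gamma> i) * K = 0 \<and> (\<Gamma> j - \<Gamma> i) * L = 0 \<and>
    (\<Gamma> i + \<Gamma> j) * (K * p) + \<Gamma> l * (B * (p - q)) = 0 \<and>
    (\<Gamma> i + \<Gamma> j) * (L * q) - \<Gamma> k * (B * (p - q)) = 0"
proof -
  let ?s = "squared_distances x"
  have S: "S (-1) ?s i j = A" "S (-1) ?s j i = A" "S (-1) ?s k l = B" "S (-1) ?s l k = B"
    "S (-1) ?s i k = K" "S (-1) ?s k i = K" "S (-1) ?s j k = K" "S (-1) ?s k j = K"
    "S (-1) ?s i l = L" "S (-1) ?s l i = L" "S (-1) ?s j l = L" "S (-1) ?s l j = L"
    "S (-1) ?s t t = 0" for t
    using distinct distances
      distance_sym[of i j] distance_sym[of k l] distance_sym[of i k] distance_sym[of j k]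
      distance_sym[of i l] distance_sym[of j l]
    by (simp_all add: S_def A_def B_def K_def L_def)
  define V where "V t = (\<Sum>r\<in>UNIV. (\<Gamma> r * S (-1) ?s t r) *\<^sub>R (x r - x t))" for t
  have V: "V i \<bullet> e = a * (2 * \<Gamma> j * A + \<Gamma> k * K + \<Gamma> l * L)"
    "V i \<bullet> n = \<Gamma> k * (K * p) + \<Gamma> l * (L * q)"
    "V j \<bullet> e = - a * (2 * \<Gamma> i * A + \<Gamma> k * K + \<Gamma> l * L)"
    "V j \<bullet> n = \<Gamma> k * (K * p) + \<Gamma> l * (L * q)"
    "V k \<bullet> e = a * ((\<Gamma> j - \<Gamma> i) * K)"
    "V k \<bullet> n = - ((\<Gamma> i + \<Gamma> j) * (K * p) + \<Gamma> l * (B * (p - q)))"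
    "V l \<bullet> e = a * ((\<Gamma> j - \<Gamma> i) * L)"
    "V l \<bullet> n = - ((\<Gamma> i + \<Gamma> j) * (L * q) - \<Gamma> k * (B * (p - q)))"
    unfolding V_def sum_labels S pos
    by (simp_all add: inner_diff_left inner_add_left algebra_simps vec_times_2)
  have "balanced \<Gamma> x \<longleftrightarrow> V i = 0 \<and> V j = 0 \<and> V k = 0 \<and> V l = 0"
    unfolding balanced_def V_def[symmetric] using label_cases by metis
  thus ?thesis unfolding zero_iff V using nondegenerate(1) by auto
qed

text \<open>
  Unequal strengths would pull the axis vortices off the axis unless \<open>S i k\<close> and \<open>S i l\<close> both vanish,
  and then both axis vortices would be at distance 1 from the other two, so that the kite would be a
  rhombus.
\<close>

lemma balanced_imp_equal_strengths:
  assumes "balanced \<Gamma> x" and "p\<^sup>2 \<noteq> q\<^sup>2"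
  shows "\<Gamma> i = \<Gamma> j"
proof (rule ccontr)
  assume "\<Gamma> i \<noteq> \<Gamma> j"
  hence "1 / (a\<^sup>2 + p\<^sup>2) - 1 = 0" "1 / (a\<^sup>2 + q\<^sup>2) - 1 = 0"
    using assms(1) unfolding balanced_iff by auto
  thus False using assms(2) nondegenerate by (auto split: if_splits)
qed

lemma balanced_iff_kite_equations:
  assumes "\<Gamma> i = \<mu>" "\<Gamma> j = \<mu>" "\<Gamma> k = \<rho> * \<mu>" "\<Gamma> l = \<rho> * \<mu>" and \<mu>: "\<mu> \<noteq> 0" and \<rho>: "\<rho> \<noteq> 0"
  shows "balanced \<Gamma> x \<longleftrightarrow> kite_equations \<rho> (a\<^sup>2) p q"
proof -
  define A B K L where "A = 1 / (4 * a\<^sup>2) - 1" and "B = 1 / (p - q)\<^sup>2 - 1"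
    and "K = 1 / (a\<^sup>2 + p\<^sup>2) - 1" and "L = 1 / (a\<^sup>2 + q\<^sup>2) - 1"
  have "2 * \<mu> * A + \<rho> * \<mu> * K + \<rho> * \<mu> * L = \<mu> * (2 * A + \<rho> * (K + L))"
    "\<rho> * \<mu> * (K * p) + \<rho> * \<mu> * (L * q) = (\<rho> * \<mu>) * (K * p + L * q)"
    "(\<mu> + \<mu>) * (K * p) + \<rho> * \<mu> * (B * (p - q)) = \<mu> * (2 * K * p + \<rho> * B * (p - q))"
    "(\<mu> + \<mu>) * (L * q) - \<rho> * \<mu> * (B * (p - q))
       = 2 * \<mu> * (K * p + L * q) - \<mu> * (2 * K * p + \<rho> * B * (p - q))"
    by (simp_all add: algebra_simps)
  thus ?thesis
    unfolding balanced_iff assms(1-4) kite_equations_def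
      A_def[symmetric] B_def[symmetric] K_def[symmetric] L_def[symmetric]
    using \<mu> \<rho> by auto
qed

text \<open>
  A kite spans the plane, so a vector that is orthogonal to all differences of positions is zero.
\<close>

lemma unsym_imp_balanced:
  assumes "unsym_albouy_chenciner (-1) \<Gamma> (squared_distances x)"
  shows "balanced \<Gamma> x"
  unfolding balanced_def
proof
  fix t
  let ?v = "\<Sum>r\<in>UNIV. (\<Gamma> r * S (-1) (squared_distances x) t r) *\<^sub>R (x r - x t)"
  have "?v \<bullet> (x r - x t) = 0" for r
    using assms unsym_as_projection[of \<Gamma> "-1" x t r]
    by (cases "r = t") (auto simp: unsym_albouy_chenciner_def)
  hence *: "?v \<bullet> x r = ?v \<bullet> x t" for r by (simp add: inner_diff_right)
  have "?v \<bullet> x j = ?v \<bullet> x i" "?v \<bullet> x k = ?v \<bullet> x l"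
    using *[of i] *[of j] *[of k] *[of l] by simp_all
  thus "?v = 0" unfolding zero_iff using nondegenerate
    by (simp add: pos inner_add_right inner_diff_right)
qed

lemma not_collinear_triple:
  assumes "p \<noteq> 0" "q \<noteq> 0"
  shows "\<not> collinear (x ` (UNIV - {t}))"
proof
  assume col: "collinear (x ` (UNIV - {t}))"
  \<comment> \<open>parallel vectors have a vanishing determinant with respect to the frame\<close>
  have *: "((y - z) \<bullet> e) * ((w - z) \<bullet> n) = ((y - z) \<bullet> n) * ((w - z) \<bullet> e)"
    if mem: "y \<in> x ` (UNIV - {t})" "z \<in> x ` (UNIV - {t})" "w \<in> x ` (UNIV - {t})" for y z w
  proof -
    obtain u where "\<forall>y \<in> x ` (UNIV - {t}). \<forall>z \<in> x ` (UNIV - {t}). \<exists>r. y - z = r *\<^sub>R u"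
      using col unfolding collinear_def by blast
    then obtain r s where "y - z = r *\<^sub>R u" "w - z = s *\<^sub>R u" using mem by metis
    thus ?thesis by simp
  qed
  note ** = *[OF imageI imageI imageI]
  from label_cases[of t] show False
    using **[of i j k] **[of i j l] **[of k i l] **[of k j l] distinct nondegenerate assms
    by (elim disjE)
      (auto simp: pos inner_diff_left inner_add_left vec_times_2)
qed

lemma no_three_collinear:
  assumes "p \<noteq> 0" "q \<noteq> 0"
  shows "no_three_collinear x"
  unfolding no_three_collinear_def
proof (intro allI impI)
  fix r s t :: 4 assume d: "r \<noteq> s \<and> r \<noteq> t \<and> s \<noteq> t"
  hence "card (UNIV - {r, s, t}) = 1" by (simp add: card_Diff_subset)
  then obtain z where z: "UNIV - {r, s, t} = {z}" by (rule card_1_singletonE)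
  hence "{r, s, t} = UNIV - {z}" by auto
  hence "x ` (UNIV - {z}) = {x r, x s, x t}" by (metis image_insert image_empty)
  thus "\<not> collinear {x r, x s, x t}" using not_collinear_triple[OF assms, of z] by simp
qed

text \<open>
  Vortex \<open>k\<close> lies strictly between \<open>l\<close> and the midpoint \<open>c\<close> of \<open>i\<close> and \<open>j\<close>.
\<close>

lemma interior_if_between:
  assumes "q \<noteq> 0" "0 < p / q" "p / q < 1"
  shows "x k \<in> interior (convex hull (x ` (UNIV - {k})))"
proof -
  have "p \<noteq> 0" using assms by auto
  have U: "UNIV - {k} = {i, j, l}" using labels distinct by auto
  hence img: "x ` (UNIV - {k}) = {x i, x j, x l}" by simp
  define s where "s = p / q"
  have s: "0 < s" "s < 1" "p = s * q" using assms by (simp_all add: s_def)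
  have "((1 - s) / 2) *\<^sub>R x i + ((1 - s) / 2) *\<^sub>R x j + s *\<^sub>R x l
      = x k"
    unfolding pos s(3) by (simp add: vec_eq_iff field_simps)
  moreover have "(1 - s) / 2 > 0" "(1 - s) / 2 + (1 - s) / 2 + s = 1" using s by simp_all
  ultimately have "x k \<in> {v. \<exists>\<alpha> \<beta> \<gamma>. 0 < \<alpha> \<and> 0 < \<beta> \<and> 0 < \<gamma> \<and> \<alpha> + \<beta> + \<gamma> = 1 \<and>
      \<alpha> *\<^sub>R x i + \<beta> *\<^sub>R x j + \<gamma> *\<^sub>R x l = v}"
    using s(1) by blast
  moreover have "\<not> collinear {x i, x j, x l}"
    using not_collinear_triple[OF \<open>p \<noteq> 0\<close> \<open>q \<noteq> 0\<close>, of k] img by simp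
  ultimately show ?thesis
    unfolding img using interior_convex_hull_3_minimal[of "x i" "x j" "x l"] by auto
qed

lemma concave_if_same_side:
  assumes "p * q > 0" shows "concave_configuration x"
proof -
  have pq: "p \<noteq> 0" "q \<noteq> 0" using assms by auto
  have s: "p / q > 0" "q / p > 0" using assms by (auto simp: zero_less_divide_iff zero_less_mult_iff)
  have "p / q < 1 \<or> q / p < 1"
  proof (rule ccontr)
    assume "\<not> ?thesis"
    hence "p / q \<ge> 1" "q / p \<ge> 1" by simp_all
    moreover have "(p / q) * (q / p) = 1" using pq by simp
    ultimately have "p / q = 1" by (smt (verit) mult_less_cancel_left1 mult_le_cancel_left1)
    thus False using pq nondegenerate by simp
  qed
  hence "\<exists>t. x t \<in> interior (convex hull (x ` (UNIV - {t})))"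
    using interior_if_between kite.interior_if_between[OF swap] pq s by blast
  thus ?thesis unfolding concave_configuration_def using no_three_collinear[OF pq] by blast
qed

text \<open>
  Each vortex is separated from the other three by a line through \<open>c\<close>: the axis for \<open>i\<close> and \<open>j\<close>, and
  the line through \<open>i\<close> and \<open>j\<close> for the two axis vortices.
\<close>

lemma convex_if_opposite_sides:
  assumes "p * q < 0" shows "convex_configuration x"
proof -
  have pq: "p \<noteq> 0" "q \<noteq> 0" using assms by auto
  have sep: "x t \<notin> convex hull (x ` (UNIV - {t}))"
    if "\<And>r. r \<noteq> t \<Longrightarrow> v \<bullet> x r \<le> b" "b < v \<bullet> x t" for t v b
  proof
    assume "x t \<in> convex hull (x ` (UNIV - {t}))"
    also have "\<dots> \<subseteq> {z. v \<bullet> z \<le> b}"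
      by (rule hull_minimal) (use that in \<open>auto simp: convex_halfspace_le\<close>)
    finally show False using that by simp
  qed
  have ax: "p * p > 0" "q * q > 0" using pq by (auto simp: zero_less_mult_iff neq_iff)
  have "x t \<notin> convex hull (x ` (UNIV - {t}))" for t
    using label_cases[of t]
  proof (elim disjE)
    assume t: "t = i"
    show ?thesis unfolding t
    proof (rule sep[of _ "-e" "- (e \<bullet> c)"])
      fix r assume "r \<noteq> i"
      thus "- e \<bullet> x r \<le> - (e \<bullet> c)" using label_cases[of r] nondegenerate by (auto simp: pos inner_add_right)
    qed (use nondegenerate in \<open>simp add: pos inner_diff_right\<close>)
  next
    assume t: "t = j"
    show ?thesis unfolding t
    proof (rule sep[of _ e "e \<bullet> c"])
      fix r assume "r \<noteq> j"
      thus "e \<bullet> x r \<le> e \<bullet> c" using label_cases[of r] nondegenerate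
        by (auto simp: pos inner_add_right inner_diff_right)
    qed (use nondegenerate in \<open>simp add: pos inner_add_right\<close>)
  next
    assume t: "t = k"
    show ?thesis unfolding t
    proof (rule sep[of _ "p *\<^sub>R n" "p * (n \<bullet> c)"])
      fix r assume "r \<noteq> k"
      thus "(p *\<^sub>R n) \<bullet> x r \<le> p * (n \<bullet> c)" using label_cases[of r] assms
        by (auto simp: pos inner_add_right inner_diff_right distrib_left)
    qed (use ax in \<open>simp add: pos inner_add_right distrib_left\<close>)
  next
    assume t: "t = l"
    show ?thesis unfolding t
    proof (rule sep[of _ "q *\<^sub>R n" "q * (n \<bullet> c)"])
      fix r assume "r \<noteq> l"
      thus "(q *\<^sub>R n) \<bullet> x r \<le> q * (n \<bullet> c)" using label_cases[of r] assms
        by (auto simp: pos inner_add_right inner_diff_right distrib_left mult.commute)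
    qed (use ax in \<open>simp add: pos inner_add_right distrib_left\<close>)
  qed
  thus ?thesis unfolding convex_configuration_def using no_three_collinear[OF pq] by blast
qed

end

text \<open>
  The two vortices \<open>k\<close>, \<open>l\<close> are each equidistant from \<open>i\<close> and \<open>j\<close>, so they lie on the line through the
  midpoint of \<open>i\<close> and \<open>j\<close> that is perpendicular to \<open>x j - x i\<close>.
\<close>

lemma strictly_kite_on_axis_obtains_kite:
  assumes inj: "inj x" and "strictly_kite_on_axis k l x"
  obtains i j c e n a p q where "kite x i j k l c e n a p q" "p + q \<noteq> 0"
proof -
  obtain i j where labels: "{i, j, k, l} = UNIV"
    and eq: "squared_distances x i k = squared_distances x j k" "squared_distances x i l = squared_distances x j l"
    and ne: "squared_distances x i k \<noteq> squared_distances x i l"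
    using assms(2) unfolding strictly_kite_on_axis_def by blast
  note d = UNIV4_distinct[OF labels]
  define c where "c = (1/2) *\<^sub>R (x i + x j)"
  define h where "h = (1/2) *\<^sub>R (x j - x i)"
  define a where "a = norm h"
  define e where "e = (1 / a) *\<^sub>R h"
  define n :: "real^2" where "n = vector [- e$2, e$1]"
  have "x i \<noteq> x j" using inj d by (simp add: inj_eq)
  hence a: "a > 0" by (simp add: a_def h_def)
  hence he: "h = a *\<^sub>R e" by (simp add: e_def)
  have e: "norm e = 1" using a by (simp add: e_def a_def)
  hence "e$1 * e$1 + e$2 * e$2 = 1"
    by (metis dot_square_norm inner_real_def inner_vec_def one_power2 sum_2)
  hence nn: "n \<bullet> n = 1" and en: "e \<bullet> n = 0" by (simp_all add: n_def inner_vec_def sum_2)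
  have n: "norm n = 1" using nn by (simp add: norm_eq_1)
  have xi: "x i = c - a *\<^sub>R e" and xj: "x j = c + a *\<^sub>R e"
    unfolding he[symmetric] by (simp_all add: c_def h_def algebra_simps vec_times_2)
  have axis: "x t = c + ((x t - c) \<bullet> n) *\<^sub>R n"
    if "squared_distances x i t = squared_distances x j t" for t
  proof -
    have "(x t - c) \<bullet> e = 0"
      using that a unfolding squared_distances_inner xi xj
      by (simp add: inner_diff_left inner_diff_right inner_add_left inner_add_right inner_commute)
    hence "(x t - c - ((x t - c) \<bullet> n) *\<^sub>R n) \<bullet> e = 0"
      using en by (simp add: inner_diff_left inner_commute[of n e])
    moreover have "(x t - c - ((x t - c) \<bullet> n) *\<^sub>R n) \<bullet> n = 0"
      using nn by (simp add: inner_diff_left)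
    ultimately have "x t - c - ((x t - c) \<bullet> n) *\<^sub>R n = 0"
      by (rule orthonormal_basis_real2[OF e n en])
    thus ?thesis by simp
  qed
  define p q where "p = (x k - c) \<bullet> n" and "q = (x l - c) \<bullet> n"
  have xk: "x k = c + p *\<^sub>R n" and xl: "x l = c + q *\<^sub>R n"
    using axis eq unfolding p_def q_def by blast+
  have "x k \<noteq> x l" using inj d by (simp add: inj_eq)
  hence "p \<noteq> q" using xk xl by auto
  hence K: "kite x i j k l c e n a p q"
    using labels e n en xi xj xk xl a by unfold_locales
  moreover have "p + q \<noteq> 0"
  proof
    assume "p + q = 0"
    hence "q = - p" by simp
    hence "p\<^sup>2 = q\<^sup>2" by simp
    thus False using ne kite.distances[OF K] by simp
  qed
  ultimately show ?thesis using that by blast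
qed

section \<open>Solutions of the system and admissible roots\<close>

text \<open>
  The squared distances of a kite with axis vortices \<open>k\<close> and \<open>l\<close>: \<open>E\<close> between the off-axis vortices,
  \<open>P\<close> and \<open>Q\<close> from these to \<open>k\<close> and to \<open>l\<close>, and \<open>D\<close> between \<open>k\<close> and \<open>l\<close>.
\<close>

definition kite_distances :: "4 \<Rightarrow> 4 \<Rightarrow> real \<Rightarrow> real \<Rightarrow> real \<Rightarrow> real \<Rightarrow> 4 \<Rightarrow> 4 \<Rightarrow> real" where
  "kite_distances k l E P Q D s t =
     (if s = t then 0 else if {s, t} = {k, l} then D
      else if k \<in> {s, t} then P else if l \<in> {s, t} then Q else E)"

text \<open>
  The distances that belong to a root \<open>w\<close>, where \<open>k\<close> is the axis vortex with the larger distance to the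
  off-axis pair; \<open>P\<close> and \<open>Q\<close> are the two solutions of \<open>z\<^sup>2 - (D + 2 * w) * z + w = 0\<close>.
\<close>

definition kite_shape :: "real \<Rightarrow> 4 \<Rightarrow> 4 \<Rightarrow> real \<Rightarrow> 4 \<Rightarrow> 4 \<Rightarrow> real" where
  "kite_shape \<rho> k l w =
     (let D = kite_gap \<rho> w; r = sqrt ((D + 2 * w)\<^sup>2 - 4 * w)
      in kite_distances k l (4 * w * (1 - w) / D) ((D + 2 * w + r) / 2) ((D + 2 * w - r) / 2) D)"

lemma (in kite) squared_distances_eq:
  "squared_distances x = kite_distances k l (4 * a\<^sup>2) (a\<^sup>2 + p\<^sup>2) (a\<^sup>2 + q\<^sup>2) ((p - q)\<^sup>2)"
proof (intro ext)
  fix s t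
  have "squared_distances x r r = 0" for r by (simp add: squared_distances_def)
  moreover note distances trans[OF distance_sym distances(1)] trans[OF distance_sym distances(2)]
    trans[OF distance_sym distances(3)] trans[OF distance_sym distances(4)]
    trans[OF distance_sym distances(5)] trans[OF distance_sym distances(6)]
  ultimately show "squared_distances x s t
      = kite_distances k l (4 * a\<^sup>2) (a\<^sup>2 + p\<^sup>2) (a\<^sup>2 + q\<^sup>2) ((p - q)\<^sup>2) s t"
    using label_cases[of s] label_cases[of t] distinct
    by (elim disjE) (simp_all only: kite_distances_def doubleton_eq_iff if_True if_False simp_thms insert_iff empty_iff not_sym)
qed

lemma (in kite) squared_distances_shape:
  assumes "p + q \<noteq> 0" "\<rho> \<noteq> 0" "kite_equations \<rho> (a\<^sup>2) p q" "q\<^sup>2 \<le> p\<^sup>2"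
  shows "squared_distances x = kite_shape \<rho> k l ((a\<^sup>2 + p\<^sup>2) * (a\<^sup>2 + q\<^sup>2))"
proof -
  define w where "w = (a\<^sup>2 + p\<^sup>2) * (a\<^sup>2 + q\<^sup>2)"
  have "a\<^sup>2 > 0" using nondegenerate by simp
  note roots = kite_equations_roots[OF this nondegenerate(2) assms(1,2,3), folded w_def]
  have "(kite_gap \<rho> w + 2 * w)\<^sup>2 - 4 * w = (p\<^sup>2 - q\<^sup>2)\<^sup>2"
    unfolding roots(3)[symmetric] unfolding w_def by (simp add: power2_eq_square algebra_simps)
  hence "sqrt ((kite_gap \<rho> w + 2 * w)\<^sup>2 - 4 * w) = p\<^sup>2 - q\<^sup>2" using assms(4) by simp
  moreover have "(kite_gap \<rho> w + 2 * w + (p\<^sup>2 - q\<^sup>2)) / 2 = a\<^sup>2 + p\<^sup>2"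
    "(kite_gap \<rho> w + 2 * w - (p\<^sup>2 - q\<^sup>2)) / 2 = a\<^sup>2 + q\<^sup>2"
    unfolding roots(3)[symmetric] by simp_all
  ultimately show ?thesis
    unfolding squared_distances_eq kite_shape_def Let_def w_def[symmetric] roots(2,4) by (simp only:)
qed

lemma kite_from_root:
  assumes labels: "{i, j, k, l} = (UNIV :: 4 set)" and w: "w \<in> kite_roots \<rho>" and \<rho>: "\<rho> \<noteq> 0"
  obtains x c e n a p q where "kite x i j k l c e n a p q" "p\<^sup>2 \<noteq> q\<^sup>2"
    "kite_equations \<rho> (a\<^sup>2) p q" "squared_distances x = kite_shape \<rho> k l w"
proof -
  obtain u p q where u: "u > 0" "p \<noteq> q" "p + q \<noteq> 0" "kite_equations \<rho> u p q"
    "(u + p\<^sup>2) * (u + q\<^sup>2) = w" "u + q\<^sup>2 < u + p\<^sup>2"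
    using kite_roots_equations[OF w] by blast
  define a where "a = sqrt u"
  have a: "a > 0" "a\<^sup>2 = u" using u(1) by (simp_all add: a_def)
  define e n :: "real^2" where "e = axis 1 1" and "n = axis 2 1"
  define x where "x t = (if t = i then 0 - a *\<^sub>R e else if t = j then 0 + a *\<^sub>R e
    else if t = k then 0 + p *\<^sub>R n else 0 + q *\<^sub>R n)" for t
  have "norm e = 1" "norm n = 1" "e \<bullet> n = 0"
    by (simp_all add: e_def n_def inner_axis_axis)
  hence K: "kite x i j k l 0 e n a p q"
    using labels a u(2) UNIV4_distinct[OF labels] by unfold_locales (simp_all add: x_def)
  moreover have "p\<^sup>2 \<noteq> q\<^sup>2" using u(6) by simp
  moreover have "kite_equations \<rho> (a\<^sup>2) p q" using u(4) a by simp
  moreover have "squared_distances x = kite_shape \<rho> k l w"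
    using kite.squared_distances_shape[OF K u(3) \<rho>] u(4,5,6) a(2) by simp
  ultimately show ?thesis by (rule that)
qed

text \<open>
  Eliminating \<open>A\<close> and \<open>B\<close> by the first and the third equation and then using the second gives
  \<open>\<rho> * (p - q) * A * B = \<rho> * (p - q) * K * L\<close>.
\<close>

lemma kite_equations_imp_dziobek:
  assumes "kite_equations \<rho> u p q" "\<rho> \<noteq> 0" "p \<noteq> q"
  shows "(1 / (4 * u) - 1) * (1 / (p - q)\<^sup>2 - 1) = (1 / (u + p\<^sup>2) - 1) * (1 / (u + q\<^sup>2) - 1)"
proof -
  define A B K L where "A = 1 / (4 * u) - 1" and "B = 1 / (p - q)\<^sup>2 - 1"
    and "K = 1 / (u + p\<^sup>2) - 1" and "L = 1 / (u + q\<^sup>2) - 1"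
  have "2 * A + \<rho> * (K + L) = 0" "K * p + L * q = 0" "2 * K * p + \<rho> * B * (p - q) = 0"
    using assms(1) unfolding kite_equations_def A_def B_def K_def L_def by simp_all
  hence "2 * (\<rho> * (p - q) * (A * B - K * L)) = 0" by algebra
  hence "A * B = K * L" using assms(2,3) by simp
  thus ?thesis unfolding A_def B_def K_def L_def .
qed

text \<open>
  In a kite, two of the three ways to split the vortices into pairs give the same two distances \<open>P\<close>, \<open>Q\<close>
  and the third gives \<open>E\<close>, \<open>D\<close>; hence all Dziobek equations reduce to one. Applied with
  \<open>g d = 1 / d - 1\<close>.
\<close>

lemma kite_distances_opposite:
  fixes g :: "real \<Rightarrow> real"
  assumes "{s, t, s', t'} = (UNIV :: 4 set)" "k \<noteq> l" and eq: "g E * g D = g P * g Q"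
  shows "g (kite_distances k l E P Q D s t) * g (kite_distances k l E P Q D s' t') = g P * g Q"
proof -
  have "k = s \<or> k = t \<or> k = s' \<or> k = t'" "l = s \<or> l = t \<or> l = s' \<or> l = t'"
    using assms(1) by auto
  moreover have "g D * g E = g P * g Q" "g Q * g P = g P * g Q" using eq by (simp_all add: mult.commute)
  ultimately show ?thesis using UNIV4_distinct[OF assms(1)] eq \<open>k \<noteq> l\<close>
    by (elim disjE) (simp_all add: kite_distances_def doubleton_eq_iff)
qed

definition kite_strengths :: "(4 \<Rightarrow> real) \<Rightarrow> real \<Rightarrow> 4 \<Rightarrow> 4 \<Rightarrow> 4 \<Rightarrow> 4 \<Rightarrow> bool" where
  "kite_strengths \<Gamma> \<rho> i j k l \<longleftrightarrow> \<Gamma> i \<noteq> 0 \<and> \<Gamma> j = \<Gamma> i \<and> \<Gamma> k = \<rho> * \<Gamma> i \<and> \<Gamma> l = \<rho> * \<Gamma> i \<and> \<rho> \<noteq> 0"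

text \<open>
  The sign of \<open>p * q\<close> is that of \<open>\<rho> / (\<rho> + 2)\<close>, which separates concave from convex kites.
\<close>

lemma (in kite) balanced_kite:
  assumes bal: "balanced \<Gamma> x" and str: "kite_strengths \<Gamma> \<rho> i j k l" and strict: "p + q \<noteq> 0"
  shows "squared_distances x \<in> kite_shape \<rho> k l ` kite_roots \<rho> \<union> kite_shape \<rho> l k ` kite_roots \<rho>"
    and "\<rho> < -2 \<or> 0 < \<rho> \<Longrightarrow> concave_configuration x"
    and "-2 < \<rho> \<Longrightarrow> \<rho> < 0 \<Longrightarrow> convex_configuration x"
proof -
  have \<rho>: "\<rho> \<noteq> 0" using str by (simp add: kite_strengths_def)
  have eq: "kite_equations \<rho> (a\<^sup>2) p q"
    using bal str balanced_iff_kite_equations[of \<Gamma> "\<Gamma> i" \<rho>] by (simp add: kite_strengths_def)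
  have eq': "kite_equations \<rho> (a\<^sup>2) q p"
    using bal str kite.balanced_iff_kite_equations[OF swap, of \<Gamma> "\<Gamma> i" \<rho>] by (simp add: kite_strengths_def)
  have a2: "a\<^sup>2 > 0" using nondegenerate by simp
  define w where "w = (a\<^sup>2 + p\<^sup>2) * (a\<^sup>2 + q\<^sup>2)"
  note roots = kite_equations_roots[OF a2 nondegenerate(2) strict \<rho> eq, folded w_def]
  have "squared_distances x = kite_shape \<rho> k l w \<or> squared_distances x = kite_shape \<rho> l k w"
  proof (cases "q\<^sup>2 \<le> p\<^sup>2")
    case True
    thus ?thesis using squared_distances_shape[OF strict \<rho> eq] by (simp add: w_def)
  next
    case False
    thus ?thesis using kite.squared_distances_shape[OF swap _ \<rho> eq'] strict
      by (simp add: w_def mult.commute add.commute)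
  qed
  thus "squared_distances x \<in> kite_shape \<rho> k l ` kite_roots \<rho> \<union> kite_shape \<rho> l k ` kite_roots \<rho>"
    using roots(1) by blast
  have w2: "w\<^sup>2 > 0" and gap: "kite_gap \<rho> w > 0" using roots(1) by (auto simp: kite_roots_def)
  {
    assume "\<rho> < -2 \<or> 0 < \<rho>"
    hence "p * q > 0"
    proof
      assume "0 < \<rho>"
      hence "p * q * ((\<rho> + 2) * kite_gap \<rho> w) > 0" unfolding roots(5) using w2 by simp
      moreover have "(\<rho> + 2) * kite_gap \<rho> w > 0" using gap \<open>0 < \<rho>\<close> by simp
      ultimately show ?thesis by (metis zero_less_mult_pos2)
    next
      assume "\<rho> < -2"
      hence "p * q * ((\<rho> + 2) * kite_gap \<rho> w) < 0" unfolding roots(5) using w2 by (simp add: mult_neg_pos)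
      moreover have "(\<rho> + 2) * kite_gap \<rho> w < 0" using gap \<open>\<rho> < -2\<close> by (simp add: mult_neg_pos)
      ultimately show ?thesis by (metis mult_less_0_iff less_asym)
    qed
    thus "concave_configuration x" by (rule concave_if_same_side)
  next
    assume "-2 < \<rho>" "\<rho> < 0"
    hence "p * q * ((\<rho> + 2) * kite_gap \<rho> w) < 0" unfolding roots(5) using w2 by (simp add: mult_neg_pos)
    moreover have "(\<rho> + 2) * kite_gap \<rho> w > 0" using gap \<open>-2 < \<rho>\<close> by simp
    ultimately have "p * q < 0" by (metis mult_less_0_iff less_asym)
    thus "convex_configuration x" by (rule convex_if_opposite_sides)
  }
qed

lemma positive_solution_inj:
  assumes "real_positive_solution \<Gamma> (squared_distances x)"
  shows "inj x"
proof (rule injI, rule ccontr)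
  fix s t assume "x s = x t" "s \<noteq> t"
  thus False using assms by (auto simp: real_positive_solution_def squared_distances_def)
qed

lemma strictly_kite_obtains_balanced_kite:
  assumes "inj x" and "unsym_albouy_chenciner (-1) \<Gamma> (squared_distances x)"
    and "strictly_kite_on_axis k l x"
  obtains i j c e n a p q where "kite x i j k l c e n a p q" "p + q \<noteq> 0" "balanced \<Gamma> x" "\<Gamma> i = \<Gamma> j"
proof -
  obtain i j c e n a p q where K: "kite x i j k l c e n a p q" "p + q \<noteq> 0"
    using strictly_kite_on_axis_obtains_kite[OF assms(1,3)] by blast
  have "balanced \<Gamma> x" using kite.unsym_imp_balanced[OF K(1) assms(2)] .
  moreover have "p\<^sup>2 \<noteq> q\<^sup>2" using K(2) kite.nondegenerate(2)[OF K(1)] by (auto simp: power2_eq_iff)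
  ultimately show ?thesis using that K kite.balanced_imp_equal_strengths[OF K(1)] by blast
qed

text \<open>
  All equations of the system follow from equilibrium, together with planarity for the Cayley-Menger
  determinant.
\<close>

lemma (in kite) balanced_solution:
  assumes bal: "balanced \<Gamma> x" and str: "kite_strengths \<Gamma> \<rho> i j k l" and strict: "p\<^sup>2 \<noteq> q\<^sup>2"
  shows "real_positive_solution \<Gamma> (squared_distances x)"
  unfolding real_positive_solution_def E_tilde_def
proof (intro conjI allI impI)
  let ?s = "squared_distances x"
  have a2: "a\<^sup>2 > 0" using nondegenerate by simp
  have inj: "inj x"
  proof (rule injI, rule ccontr)
    fix s t assume "x s = x t" "s \<noteq> t"
    moreover have "?s s t \<noteq> 0"
      using \<open>s \<noteq> t\<close> a2 nondegenerate add_pos_nonneg[OF a2, of "p\<^sup>2"] add_pos_nonneg[OF a2, of "q\<^sup>2"]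
      unfolding squared_distances_eq by (simp add: kite_distances_def)
    ultimately show False by (simp add: squared_distances_def)
  qed
  show "?s s s = 0" for s by (simp add: squared_distances_def)
  show "?s s t = ?s t s" for s t by (rule distance_sym)
  show "0 < ?s s t" if "s \<noteq> t" for s t
    using that inj by (simp add: squared_distances_def inj_eq)
  show unsym: "unsym_albouy_chenciner (-1) \<Gamma> ?s" using bal by (rule balanced_imp_unsym)
  show "albouy_chenciner (-1) \<Gamma> ?s" by (rule unsym_imp_sym[OF unsym distance_sym])
  show "cayley_menger ?s = 0" using inj by (rule cayley_menger_planar)
  have "kite_equations \<rho> (a\<^sup>2) p q" and \<rho>: "\<rho> \<noteq> 0"
    using bal str balanced_iff_kite_equations[of \<Gamma> "\<Gamma> i" \<rho>] by (simp_all add: kite_strengths_def)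
  hence "(1 / (4 * a\<^sup>2) - 1) * (1 / (p - q)\<^sup>2 - 1) = (1 / (a\<^sup>2 + p\<^sup>2) - 1) * (1 / (a\<^sup>2 + q\<^sup>2) - 1)"
    using nondegenerate(2) by (intro kite_equations_imp_dziobek)
  note opposite = kite_distances_opposite[where g = "\<lambda>d. 1 / d - 1", OF _ distinct(6) this, folded squared_distances_eq]
  have "{1, 2, 3, 4} = (UNIV :: 4 set)" "{1, 3, 2, 4} = (UNIV :: 4 set)" "{1, 4, 2, 3} = (UNIV :: 4 set)"
    by (auto simp: UNIV_4)
  note this[THEN opposite]
  thus "dziobek (-1) ?s" unfolding dziobek_def by simp
qed

lemma kite_strengths_swap: "kite_strengths \<Gamma> \<rho> i j k l \<Longrightarrow> kite_strengths \<Gamma> \<rho> i j l k"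
  by (simp add: kite_strengths_def)

lemma solutions_with_mono:
  "(\<And>x. P x \<Longrightarrow> Q x) \<Longrightarrow> solutions_with \<Gamma> P \<subseteq> solutions_with \<Gamma> Q"
  by (auto simp: solutions_with_def)

lemma strictly_kite_on_axis_swap:
  assumes "strictly_kite_on_axis k l x" shows "strictly_kite_on_axis l k x"
proof -
  obtain i j where "{i, j, k, l} = UNIV" "squared_distances x i k = squared_distances x j k"
    "squared_distances x i l = squared_distances x j l" "squared_distances x i k \<noteq> squared_distances x i l"
    using assms unfolding strictly_kite_on_axis_def by blast
  moreover from this(1) have "{i, j, l, k} = UNIV" by auto
  ultimately show ?thesis unfolding strictly_kite_on_axis_def
    by (intro exI[of _ i] exI[of _ j] conjI) simp_all
qed

lemma strictly_kite_on_axis_iff: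
  assumes labels: "{i, j, k, l} = (UNIV :: 4 set)"
  shows "strictly_kite_on_axis k l x \<longleftrightarrow> squared_distances x i k = squared_distances x j k \<and>
    squared_distances x i l = squared_distances x j l \<and> squared_distances x i k \<noteq> squared_distances x i l"
proof
  assume "strictly_kite_on_axis k l x"
  then obtain i' j' where ij: "{i', j', k, l} = UNIV" "squared_distances x i' k = squared_distances x j' k"
    "squared_distances x i' l = squared_distances x j' l" "squared_distances x i' k \<noteq> squared_distances x i' l"
    unfolding strictly_kite_on_axis_def by blast
  have "i' \<in> {i, j, k, l}" "j' \<in> {i, j, k, l}" unfolding labels by simp_all
  hence "i' = i \<and> j' = j \<or> i' = j \<and> j' = i" using UNIV4_distinct[OF ij(1)] by auto
  thus "squared_distances x i k = squared_distances x j k \<and>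
    squared_distances x i l = squared_distances x j l \<and> squared_distances x i k \<noteq> squared_distances x i l"
    using ij(2-4) by (elim disjE conjE) simp_all
next
  assume "squared_distances x i k = squared_distances x j k \<and>
    squared_distances x i l = squared_distances x j l \<and> squared_distances x i k \<noteq> squared_distances x i l"
  thus "strictly_kite_on_axis k l x" using labels unfolding strictly_kite_on_axis_def by blast
qed

lemma positive_solution_unsym:
  "real_positive_solution \<Gamma> s \<Longrightarrow> unsym_albouy_chenciner (-1) \<Gamma> s"
  by (simp add: real_positive_solution_def E_tilde_def)

lemma kite_shape_solution:
  assumes labels: "{i, j, k, l} = (UNIV :: 4 set)" and str: "kite_strengths \<Gamma> \<rho> i j k l"
    and w: "w \<in> kite_roots \<rho>"
  shows "kite_shape \<rho> k l w \<in> solutions_with \<Gamma> (strictly_kite_on_axis k l)"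
proof -
  have \<rho>: "\<rho> \<noteq> 0" using str by (simp add: kite_strengths_def)
  obtain x c e n a p q where K: "kite x i j k l c e n a p q" and pq: "p\<^sup>2 \<noteq> q\<^sup>2"
    and eq: "kite_equations \<rho> (a\<^sup>2) p q" and s: "squared_distances x = kite_shape \<rho> k l w"
    using kite_from_root[OF labels w \<rho>] by blast
  have "balanced \<Gamma> x"
    using eq str kite.balanced_iff_kite_equations[OF K, of \<Gamma> "\<Gamma> i" \<rho>] by (simp add: kite_strengths_def)
  hence "real_positive_solution \<Gamma> (squared_distances x)"
    using kite.balanced_solution[OF K] str pq by blast
  moreover have "strictly_kite_on_axis k l x"
    unfolding strictly_kite_on_axis_def using labels kite.distances[OF K] pq
    by (intro exI[of _ i] exI[of _ j]) simp
  ultimately show ?thesis unfolding solutions_with_def using s by auto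
qed

lemma solutions_on_axis:
  assumes labels: "{i, j, k, l} = (UNIV :: 4 set)" and str: "kite_strengths \<Gamma> \<rho> i j k l"
  shows "solutions_with \<Gamma> (strictly_kite_on_axis k l) =
    kite_shape \<rho> k l ` kite_roots \<rho> \<union> kite_shape \<rho> l k ` kite_roots \<rho>" (is "?S = ?T")
proof
  show "?S \<subseteq> ?T"
  proof
    fix s assume "s \<in> ?S"
    then obtain x where x: "s = squared_distances x" "real_positive_solution \<Gamma> (squared_distances x)"
      "strictly_kite_on_axis k l x" unfolding solutions_with_def by blast
    obtain i' j' c e n a p q where K: "kite x i' j' k l c e n a p q" "p + q \<noteq> 0" "balanced \<Gamma> x"
      "\<Gamma> i' = \<Gamma> j'"
      by (rule strictly_kite_obtains_balanced_kite[OF positive_solution_inj[OF x(2)] positive_solution_unsym[OF x(2)] x(3)])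
    have "i' \<in> {i, j, k, l}" "j' \<in> {i, j, k, l}" unfolding labels by simp_all
    hence "i' \<in> {i, j}" "j' \<in> {i, j}" using kite.distinct[OF K(1)] by auto
    hence "\<Gamma> i' = \<Gamma> i" "\<Gamma> j' = \<Gamma> i" using str unfolding kite_strengths_def by blast+
    hence "kite_strengths \<Gamma> \<rho> i' j' k l" using str by (simp add: kite_strengths_def)
    from kite.balanced_kite(1)[OF K(1) K(3) this K(2)] show "s \<in> ?T" unfolding x(1) .
  qed
  have labels': "{i, j, l, k} = UNIV" using labels by auto
  have swap: "solutions_with \<Gamma> (strictly_kite_on_axis l k) \<subseteq> ?S"
    by (rule solutions_with_mono) (rule strictly_kite_on_axis_swap)
  show "?T \<subseteq> ?S"
  proof (intro Un_least image_subsetI)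
    fix w assume w: "w \<in> kite_roots \<rho>"
    show "kite_shape \<rho> k l w \<in> ?S" by (rule kite_shape_solution[OF labels str w])
    show "kite_shape \<rho> l k w \<in> ?S"
      using kite_shape_solution[OF labels' kite_strengths_swap[OF str] w] swap by (rule rev_subsetD)
  qed
qed

text \<open>
  Why different roots and different labels give different solutions: the root is the product \<open>P * Q\<close>,
  and the axis vortex farther from the off-axis pair is named first.
\<close>

lemma kite_shape_recover:
  assumes "w \<in> kite_roots \<rho>" "i \<noteq> k" "i \<noteq> l" "k \<noteq> l"
  shows "kite_shape \<rho> k l w i k * kite_shape \<rho> k l w i l = w"
    "kite_shape \<rho> k l w i l < kite_shape \<rho> k l w i k"
proof -
  define D r where "D = kite_gap \<rho> w" and "r = sqrt ((D + 2 * w)\<^sup>2 - 4 * w)"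
  have "(D + 2 * w)\<^sup>2 - 4 * w > 0" using assms(1) by (simp add: kite_roots_def D_def)
  hence r: "r > 0" "r\<^sup>2 = (D + 2 * w)\<^sup>2 - 4 * w" by (simp_all add: r_def)
  have v: "kite_shape \<rho> k l w i k = (D + 2 * w + r) / 2" "kite_shape \<rho> k l w i l = (D + 2 * w - r) / 2"
    unfolding kite_shape_def Let_def D_def[symmetric] r_def[symmetric]
    using assms(2-4) by (simp_all add: kite_distances_def doubleton_eq_iff)
  have "(D + 2 * w + r) * (D + 2 * w - r) = (D + 2 * w)\<^sup>2 - r\<^sup>2"
    by (simp add: power2_eq_square algebra_simps)
  thus "kite_shape \<rho> k l w i k * kite_shape \<rho> k l w i l = w" unfolding v r(2) by simp
  show "kite_shape \<rho> k l w i l < kite_shape \<rho> k l w i k" unfolding v using r by simp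
qed

lemma card_solutions_on_axis:
  assumes labels: "{i, j, k, l} = (UNIV :: 4 set)" and str: "kite_strengths \<Gamma> \<rho> i j k l"
    and fin: "finite (kite_roots \<rho>)"
  shows "finite (solutions_with \<Gamma> (strictly_kite_on_axis k l))"
    and "card (solutions_with \<Gamma> (strictly_kite_on_axis k l)) = 2 * card (kite_roots \<rho>)"
proof -
  note d = UNIV4_distinct[OF labels]
  have inj: "inj_on (kite_shape \<rho> k l) (kite_roots \<rho>)" "inj_on (kite_shape \<rho> l k) (kite_roots \<rho>)"
    using kite_shape_recover(1)[of _ \<rho> i] d unfolding inj_on_def by metis+
  have "kite_shape \<rho> k l w \<noteq> kite_shape \<rho> l k w'" if "w \<in> kite_roots \<rho>" "w' \<in> kite_roots \<rho>" for w w'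
    using kite_shape_recover(2)[OF that(1), of i k l] kite_shape_recover(2)[OF that(2), of i l k] d by auto
  hence "kite_shape \<rho> k l ` kite_roots \<rho> \<inter> kite_shape \<rho> l k ` kite_roots \<rho> = {}" by blast
  thus "card (solutions_with \<Gamma> (strictly_kite_on_axis k l)) = 2 * card (kite_roots \<rho>)"
    unfolding solutions_on_axis[OF labels str]
    using fin inj by (simp add: card_Un_disjoint card_image)
  show "finite (solutions_with \<Gamma> (strictly_kite_on_axis k l))"
    unfolding solutions_on_axis[OF labels str] using fin by simp
qed

lemma vortex_strength_cases:
  assumes labels: "{i, j, k, l} = (UNIV :: 4 set)" and "m \<noteq> 0"
    and eq: "vortex_strength m i = vortex_strength m j"
  obtains (axis34) "{k, l} = {3, 4}" "kite_strengths (vortex_strength m) m i j k l"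
  | (axis12) "{k, l} = {1, 2}" "kite_strengths (vortex_strength m) (1 / m) i j k l"
  | (equal) "m = 1" "kite_strengths (vortex_strength m) 1 i j k l"
proof (cases "m = 1")
  case True
  thus ?thesis using equal by (simp add: kite_strengths_def vortex_strength_def)
next
  case False
  note d = UNIV4_distinct[OF labels]
  have "{i, j, k, l} - {i, j} = {k, l}" using d by auto
  hence kl: "{k, l} = UNIV - {i, j}" unfolding labels by simp
  have one_iff: "vortex_strength m t = 1 \<longleftrightarrow> t \<in> {1, 2}" for t
    using False by (simp add: vortex_strength_def)
  show ?thesis
  proof (cases "i \<in> {1, 2}")
    case True
    hence "j \<in> {1, 2}" using eq one_iff by metis
    hence "{i, j} = {1, 2}" using True d(1) by auto
    moreover have "UNIV - {1, 2} = {3, 4 :: 4}" unfolding UNIV_4 by auto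
    ultimately have "{k, l} = {3, 4}" using kl by simp
    moreover have "vortex_strength m t = m" if "t \<in> {3, 4}" for t
      using that by (auto simp: vortex_strength_def)
    ultimately have "vortex_strength m k = m" "vortex_strength m l = m" by blast+
    moreover have "vortex_strength m i = 1" using True one_iff by blast
    ultimately show ?thesis using axis34 \<open>{k, l} = {3, 4}\<close> eq \<open>m \<noteq> 0\<close> by (simp add: kite_strengths_def)
  next
    case False
    hence "j \<notin> {1, 2}" using eq one_iff by metis
    hence "{i, j} = {3, 4}" using False d(1) exhaust_4[of i] exhaust_4[of j] by auto
    moreover have "UNIV - {3, 4} = {1, 2 :: 4}" unfolding UNIV_4 by auto
    ultimately have "{k, l} = {1, 2}" using kl by simp
    hence "vortex_strength m k = 1" "vortex_strength m l = 1" using one_iff by blast+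
    moreover have "vortex_strength m i = m" using False by (simp add: vortex_strength_def)
    ultimately show ?thesis using axis12 \<open>{k, l} = {1, 2}\<close> eq \<open>m \<noteq> 0\<close> by (simp add: kite_strengths_def)
  qed
qed

lemma kite_shape_roots_1:
  assumes "k \<noteq> l"
  shows "kite_shape 1 k l (3/4) s t = (if s = t then 0 else if l \<in> {s, t} then 1/2 else 3/2)"
proof -
  have gap: "kite_gap 1 (3/4) = 1/2" by (simp add: kite_gap_def)
  have "sqrt ((1/2 + 2 * (3/4))\<^sup>2 - 4 * (3/4)) = 1" by (simp add: power2_eq_square)
  hence shape: "kite_shape 1 k l (3/4) = kite_distances k l (3/2) (3/2) (1/2) (1/2)"
    unfolding kite_shape_def Let_def gap by simp
  have "{s, t} = {k, l} \<longleftrightarrow> k \<in> {s, t} \<and> l \<in> {s, t}" if "s \<noteq> t"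
    using that assms by (metis doubleton_eq_iff insertE insertI1 insert_commute singletonD)
  thus ?thesis unfolding shape kite_distances_def 
    by (cases "s = t"; cases "k \<in> {s, t}"; cases "l \<in> {s, t}") (simp_all only: if_True if_False simp_thms)
qed

lemma strictly_kite_solution_cases:
  assumes m: "m \<noteq> 0" and inj: "inj x"
    and unsym: "unsym_albouy_chenciner (-1) (vortex_strength m) (squared_distances x)"
    and axis: "strictly_kite_on_axis k l x"
  obtains \<rho> where "\<rho> = m \<and> {k, l} = {3, 4} \<or> \<rho> = 1 / m \<and> {k, l} = {1, 2} \<or> m = 1 \<and> \<rho> = 1"
    "k \<noteq> l"
    "squared_distances x \<in> kite_shape \<rho> k l ` kite_roots \<rho> \<union> kite_shape \<rho> l k ` kite_roots \<rho>"
    "\<rho> < -2 \<or> 0 < \<rho> \<longrightarrow> concave_configuration x"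
    "-2 < \<rho> \<and> \<rho> < 0 \<longrightarrow> convex_configuration x"
proof -
  let ?\<Gamma> = "vortex_strength m"
  obtain i j c e n a p q where K: "kite x i j k l c e n a p q" "p + q \<noteq> 0" "balanced ?\<Gamma> x" "?\<Gamma> i = ?\<Gamma> j"
    by (rule strictly_kite_obtains_balanced_kite[OF inj unsym axis])
  note r = kite.balanced_kite[OF K(1) K(3) _ K(2)]
  have "k \<noteq> l" using kite.distinct(6)[OF K(1)] .
  from kite.labels[OF K(1)] m K(4) show ?thesis
  proof (cases rule: vortex_strength_cases)
    case axis34
    show ?thesis by (rule that[of m]) (use axis34 \<open>k \<noteq> l\<close> r[OF axis34(2)] in auto)
  next
    case axis12
    show ?thesis by (rule that[of "1 / m"]) (use axis12 \<open>k \<noteq> l\<close> r[OF axis12(2)] in auto)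
  next
    case equal
    show ?thesis by (rule that[of 1]) (use equal \<open>k \<noteq> l\<close> r[OF equal(2)] in auto)
  qed
qed

text \<open>
  For equal strengths the only root belongs to the centred equilateral triangle, whose distances
  depend only on the label \<open>l\<close> of the centre. Each of the four shapes \<open>star l\<close> is found on three axes,
  so the axes must not be counted separately here.
\<close>

lemma card_strictly_kite_equal_strengths:
  "card (solutions_with (vortex_strength 1) strictly_kite) = 4"
proof -
  define star :: "4 \<Rightarrow> 4 \<Rightarrow> 4 \<Rightarrow> real" where
    "star l s t = (if s = t then 0 else if l \<in> {s, t} then 1/2 else 3/2)" for l s t
  have shape: "kite_shape 1 k l (3/4) = star l" if "k \<noteq> l" for k l
    using kite_shape_roots_1[OF that] unfolding star_def by blast
  have labels: "\<exists>i j k. {i, j, k, l} = UNIV" for l :: 4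
  proof -
    have "{2, 3, 4, 1} = (UNIV :: 4 set)" "{1, 3, 4, 2} = (UNIV :: 4 set)"
      "{1, 2, 4, 3} = (UNIV :: 4 set)" "{1, 2, 3, 4} = (UNIV :: 4 set)" by (auto simp: UNIV_4)
    thus ?thesis using exhaust_4[of l] by metis
  qed
  have "solutions_with (vortex_strength 1) strictly_kite = range star"
  proof
    show "solutions_with (vortex_strength 1) strictly_kite \<subseteq> range star"
    proof
      fix s assume "s \<in> solutions_with (vortex_strength 1) strictly_kite"
      then obtain x k l where x: "real_positive_solution (vortex_strength 1) (squared_distances x)"
        "strictly_kite_on_axis k l x" "s = squared_distances x"
        unfolding solutions_with_def strictly_kite_def by blast
      obtain \<rho> where \<rho>: "\<rho> = 1" "k \<noteq> l"
        "squared_distances x \<in> kite_shape \<rho> k l ` kite_roots \<rho> \<union> kite_shape \<rho> l k ` kite_roots \<rho>"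
        by (rule strictly_kite_solution_cases[OF one_neq_zero positive_solution_inj[OF x(1)]
              positive_solution_unsym[OF x(1)] x(2)]) auto
      hence "s = star l \<or> s = star k" using shape[of k l] shape[of l k] x(3) by (auto simp: kite_roots_1)
      thus "s \<in> range star" by blast
    qed
    show "range star \<subseteq> solutions_with (vortex_strength 1) strictly_kite"
    proof
      fix s assume "s \<in> range star"
      then obtain l where s: "s = star l" by blast
      obtain i j k where ijk: "{i, j, k, l} = UNIV" using labels by blast
      have "kite_strengths (vortex_strength 1) 1 i j k l"
        by (simp add: kite_strengths_def vortex_strength_def)
      from kite_shape_solution[OF ijk this, of "3/4"]
      have "s \<in> solutions_with (vortex_strength 1) (strictly_kite_on_axis k l)"
        using shape[OF UNIV4_distinct(6)[OF ijk]] s by (simp add: kite_roots_1)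
      thus "s \<in> solutions_with (vortex_strength 1) strictly_kite"
        unfolding solutions_with_def strictly_kite_def by blast
    qed
  qed
  moreover have "inj star"
  proof (rule injI, rule ccontr)
    fix l l' assume eq: "star l = star l'" and "l \<noteq> l'"
    obtain i j k where ijk: "{i, j, k, l} = UNIV" using labels by blast
    note d = UNIV4_distinct[OF ijk]
    obtain t where "t \<noteq> l" "t \<noteq> l'" using d by metis
    hence "star l l t = 1/2" "star l' l t = 3/2" using \<open>l \<noteq> l'\<close> by (simp_all add: star_def)
    thus False using eq by simp
  qed
  ultimately show ?thesis by (simp add: card_image)
qed

lemma vortex_labels: "{1, 2, 3, 4} = (UNIV :: 4 set)" "{3, 4, 1, 2} = (UNIV :: 4 set)"
  unfolding UNIV_4 by auto

lemma vortex_axes: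
  assumes "m \<noteq> 0"
  shows "kite_strengths (vortex_strength m) m 1 2 3 4" "kite_strengths (vortex_strength m) (1 / m) 3 4 1 2"
  using assms by (simp_all add: kite_strengths_def vortex_strength_def)

text \<open>
  The solutions on the two axes are disjoint: a strict kite with vortices 3 and 4 on the axis has
  \<open>s 1 3 \<noteq> s 1 4\<close>, one with vortices 1 and 2 on the axis has \<open>s 1 3 = s 1 4\<close>.
\<close>

lemma card_strictly_kite_distinct_strengths:
  assumes m: "m \<noteq> 0" "m \<noteq> 1" and fin: "finite (kite_roots m)" "finite (kite_roots (1 / m))"
  shows "card (solutions_with (vortex_strength m) strictly_kite)
    = 2 * card (kite_roots m) + 2 * card (kite_roots (1 / m))"
proof -
  let ?\<Gamma> = "vortex_strength m"
  let ?A = "solutions_with ?\<Gamma> (strictly_kite_on_axis 3 4)"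
  let ?B = "solutions_with ?\<Gamma> (strictly_kite_on_axis 1 2)"
  have "solutions_with ?\<Gamma> strictly_kite = ?A \<union> ?B"
  proof
    show "solutions_with ?\<Gamma> strictly_kite \<subseteq> ?A \<union> ?B"
    proof
      fix s assume "s \<in> solutions_with ?\<Gamma> strictly_kite"
      then obtain x k l where x: "real_positive_solution ?\<Gamma> (squared_distances x)"
        "strictly_kite_on_axis k l x" "s = squared_distances x"
        unfolding solutions_with_def strictly_kite_def by blast
      have "{k, l} = {3, 4} \<or> {k, l} = {1, 2}"
        by (rule strictly_kite_solution_cases[OF m(1) positive_solution_inj[OF x(1)]
              positive_solution_unsym[OF x(1)] x(2)], elim disjE conjE) (use m(2) in simp_all)
      hence "strictly_kite_on_axis 3 4 x \<or> strictly_kite_on_axis 1 2 x"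
        using x(2) strictly_kite_on_axis_swap[OF x(2)] unfolding doubleton_eq_iff by blast
      thus "s \<in> ?A \<union> ?B" using x unfolding solutions_with_def by blast
    qed
    show "?A \<union> ?B \<subseteq> solutions_with ?\<Gamma> strictly_kite"
      by (intro Un_least solutions_with_mono) (unfold strictly_kite_def, blast+)
  qed
  moreover have "?A \<inter> ?B = {}"
  proof (rule ccontr)
    assume "?A \<inter> ?B \<noteq> {}"
    then obtain s where "s \<in> ?A" "s \<in> ?B" by blast
    then obtain x y where "strictly_kite_on_axis 3 4 x" "strictly_kite_on_axis 1 2 y"
      and "squared_distances x = s" "squared_distances y = s"
      unfolding solutions_with_def by blast
    note xy = trans[OF this(3) this(4)[symmetric]]
    from \<open>strictly_kite_on_axis 3 4 x\<close> \<open>strictly_kite_on_axis 1 2 y\<close>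
    have "squared_distances y 1 3 \<noteq> squared_distances y 1 4" "squared_distances y 3 1 = squared_distances y 4 1"
      unfolding strictly_kite_on_axis_iff[OF vortex_labels(1)] strictly_kite_on_axis_iff[OF vortex_labels(2)] xy
      by simp_all
    moreover have "squared_distances y 1 3 = squared_distances y 3 1" "squared_distances y 1 4 = squared_distances y 4 1"
      by (simp_all add: squared_distances_def dist_commute)
    ultimately show False by simp
  qed
  moreover note A = card_solutions_on_axis[OF vortex_labels(1) vortex_axes(1)[OF m(1)] fin(1)]
    and B = card_solutions_on_axis[OF vortex_labels(2) vortex_axes(2)[OF m(1)] fin(2)]
  ultimately show ?thesis using card_Un_disjoint[OF A(1) B(1)] by (simp only: A(2) B(2))
qed

section \<open>The classification of strictly kite solutions\<close>

lemma solutions_with_implied_conjunct: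
  assumes "\<And>x. real_positive_solution \<Gamma> (squared_distances x) \<Longrightarrow> A x \<Longrightarrow> B x"
  shows "solutions_with \<Gamma> (\<lambda>x. A x \<and> B x) = solutions_with \<Gamma> A"
  using assms by (auto simp: solutions_with_def)

theorem theorem7p2:
  fixes m :: real and \<Gamma> :: "4 \<Rightarrow> real"
  assumes "m \<noteq> 0" and "m \<noteq> -1"
  defines "\<Gamma> \<equiv> vortex_strength m"
  shows "(m \<in> {..<-2} \<union> {-1/2<..<0} \<union> {0<..} \<longrightarrow>
            card (solutions_with \<Gamma> strictly_kite) = 4) \<and>
         (m \<in> {0<..} \<longrightarrow>
            (\<forall>x. real_positive_solution \<Gamma> (squared_distances x) \<and> strictly_kite x
                 \<longrightarrow> concave_configuration x)) \<and>
         (m \<in> {-1/2<..<0} \<longrightarrow>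
            card (solutions_with \<Gamma> (\<lambda>x. strictly_kite_on_axis 3 4 x \<and> convex_configuration x)) = 2 \<and>
            card (solutions_with \<Gamma> (\<lambda>x. strictly_kite_on_axis 1 2 x \<and> concave_configuration x)) = 2) \<and>
         (m \<in> {..<-2} \<longrightarrow>
            card (solutions_with \<Gamma> (\<lambda>x. strictly_kite_on_axis 3 4 x \<and> concave_configuration x)) = 2 \<and>
            card (solutions_with \<Gamma> (\<lambda>x. strictly_kite_on_axis 1 2 x \<and> convex_configuration x)) = 2) \<and>
         (m \<notin> {..<-2} \<union> {-1/2<..<0} \<union> {0<..} \<longrightarrow>
            solutions_with \<Gamma> strictly_kite = {} \<and>
            (\<nexists>x lam c. relative_equilibrium \<Gamma> lam c x \<and> lambda_prime \<Gamma> lam < 0 \<and> strictly_kite x))"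
proof (intro conjI impI)
  have inv1: "1 / m < -2" if "-1/2 < m" "m < 0"
    using that by (simp add: neg_divide_less_eq)
  have inv2: "-1/2 < 1 / m" "1 / m < 0" if "m < -2"
    using that by (simp_all add: neg_less_divide_eq)
  have one: "finite (kite_roots \<rho>)" "card (kite_roots \<rho>) = 1"
    if "-1/2 < \<rho> \<and> \<rho> < 0 \<or> \<rho> < -2" for \<rho>
    using card_kite_roots_one[OF that] by (simp_all add: card_ge_0_finite)
  have two: "finite (kite_roots \<rho>)" "finite (kite_roots (1 / \<rho>))"
      "card (kite_roots \<rho>) + card (kite_roots (1 / \<rho>)) = 2" if "0 < \<rho>" "\<rho> < 1" for \<rho>
    using card_kite_roots_0_1[OF that] kite_roots_gt_1[of "1 / \<rho>"] that
    by (simp_all add: card_ge_0_finite)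

  show "card (solutions_with \<Gamma> strictly_kite) = 4" if m: "m \<in> {..<-2} \<union> {-1/2<..<0} \<union> {0<..}"
  proof (cases "m = 1")
    case True
    thus ?thesis using card_strictly_kite_equal_strengths by (simp add: \<Gamma>_def)
  next
    case False
    have "finite (kite_roots m) \<and> finite (kite_roots (1 / m)) \<and>
      card (kite_roots m) + card (kite_roots (1 / m)) = 2"
    proof (cases "m < 0")
      case True
      hence "-1/2 < m \<and> m < 0 \<or> m < -2" using m by auto
      moreover from this have "-1/2 < 1 / m \<and> 1 / m < 0 \<or> 1 / m < -2"
        using inv1 inv2 by blast
      ultimately show ?thesis using one[of m] one[of "1 / m"] by simp
    next
      case nonneg: False
      show ?thesis
      proof (cases "m < 1")
        case True
        thus ?thesis using two[of m] nonneg \<open>m \<noteq> 0\<close> by simp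
      next
        case False
        hence "0 < 1 / m" "1 / m < 1" using \<open>m \<noteq> 1\<close> by simp_all
        thus ?thesis using two[of "1 / m"] by (simp add: add.commute)
      qed
    qed
    thus ?thesis unfolding \<Gamma>_def
      using card_strictly_kite_distinct_strengths[OF \<open>m \<noteq> 0\<close> \<open>m \<noteq> 1\<close>] by simp
  qed

  show "\<forall>x. real_positive_solution \<Gamma> (squared_distances x) \<and> strictly_kite x \<longrightarrow> concave_configuration x"
    if m: "m \<in> {0<..}"
  proof (intro allI impI)
    fix x assume "real_positive_solution \<Gamma> (squared_distances x) \<and> strictly_kite x"
    then obtain k l where x: "real_positive_solution (vortex_strength m) (squared_distances x)"
      "strictly_kite_on_axis k l x" unfolding strictly_kite_def \<Gamma>_def by blast
    show "concave_configuration x"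
      by (rule strictly_kite_solution_cases[OF \<open>m \<noteq> 0\<close> positive_solution_inj[OF x(1)]
            positive_solution_unsym[OF x(1)] x(2)]) (use m in auto)
  qed

  have shape34: "(m < -2 \<or> 0 < m \<longrightarrow> concave_configuration x) \<and> (-2 < m \<and> m < 0 \<longrightarrow> convex_configuration x)"
    if x: "real_positive_solution \<Gamma> (squared_distances x)" "strictly_kite_on_axis 3 4 x" "m \<noteq> 1" for x
  proof -
    note x' = x(1)[unfolded \<Gamma>_def]
    show ?thesis
      by (rule strictly_kite_solution_cases[OF \<open>m \<noteq> 0\<close> positive_solution_inj[OF x']
            positive_solution_unsym[OF x'] x(2)], elim disjE conjE)
        (use x(3) in \<open>simp_all add: doubleton_eq_iff\<close>)
  qed
  have shape12: "(1 / m < -2 \<or> 0 < 1 / m \<longrightarrow> concave_configuration x) \<and> (-2 < 1 / m \<and> 1 / m < 0 \<longrightarrow> convex_configuration x)"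
    if x: "real_positive_solution \<Gamma> (squared_distances x)" "strictly_kite_on_axis 1 2 x" "m \<noteq> 1" for x
  proof -
    note x' = x(1)[unfolded \<Gamma>_def]
    show ?thesis
      by (rule strictly_kite_solution_cases[OF \<open>m \<noteq> 0\<close> positive_solution_inj[OF x']
            positive_solution_unsym[OF x'] x(2)], elim disjE conjE)
        (use x(3) in \<open>simp_all add: doubleton_eq_iff\<close>)
  qed
  have card34: "card (solutions_with \<Gamma> (strictly_kite_on_axis 3 4)) = 2"
    if "-1/2 < m \<and> m < 0 \<or> m < -2"
    using card_solutions_on_axis(2)[OF vortex_labels(1) vortex_axes(1)[OF \<open>m \<noteq> 0\<close>] one(1)[OF that]]
      one(2)[OF that] by (simp add: \<Gamma>_def)
  have card12: "card (solutions_with \<Gamma> (strictly_kite_on_axis 1 2)) = 2"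
    if "-1/2 < 1 / m \<and> 1 / m < 0 \<or> 1 / m < -2"
    using card_solutions_on_axis(2)[OF vortex_labels(2) vortex_axes(2)[OF \<open>m \<noteq> 0\<close>] one(1)[OF that]]
      one(2)[OF that] by (simp add: \<Gamma>_def)

  show "card (solutions_with \<Gamma> (\<lambda>x. strictly_kite_on_axis 3 4 x \<and> convex_configuration x)) = 2"
    if m: "m \<in> {-1/2<..<0}"
  proof -
    have "solutions_with \<Gamma> (\<lambda>x. strictly_kite_on_axis 3 4 x \<and> convex_configuration x)
        = solutions_with \<Gamma> (strictly_kite_on_axis 3 4)"
      by (rule solutions_with_implied_conjunct) (use shape34 m in auto)
    thus ?thesis using card34 m by simp
  qed
  show "card (solutions_with \<Gamma> (\<lambda>x. strictly_kite_on_axis 1 2 x \<and> concave_configuration x)) = 2"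
    if m: "m \<in> {-1/2<..<0}"
  proof -
    have im: "1 / m < -2" using inv1 m by simp
    have "solutions_with \<Gamma> (\<lambda>x. strictly_kite_on_axis 1 2 x \<and> concave_configuration x)
        = solutions_with \<Gamma> (strictly_kite_on_axis 1 2)"
      by (rule solutions_with_implied_conjunct) (use shape12 m im in auto)
    thus ?thesis using card12 im by simp
  qed
  show "card (solutions_with \<Gamma> (\<lambda>x. strictly_kite_on_axis 3 4 x \<and> concave_configuration x)) = 2"
    if m: "m \<in> {..<-2}"
  proof -
    have "solutions_with \<Gamma> (\<lambda>x. strictly_kite_on_axis 3 4 x \<and> concave_configuration x)
        = solutions_with \<Gamma> (strictly_kite_on_axis 3 4)"
      by (rule solutions_with_implied_conjunct) (use shape34 m in auto)
    thus ?thesis using card34 m by simp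
  qed
  show "card (solutions_with \<Gamma> (\<lambda>x. strictly_kite_on_axis 1 2 x \<and> convex_configuration x)) = 2"
    if m: "m \<in> {..<-2}"
  proof -
    have im: "-1/2 < 1 / m \<and> 1 / m < 0" using inv2 m by simp
    hence "-2 < 1 / m" by linarith
    have "solutions_with \<Gamma> (\<lambda>x. strictly_kite_on_axis 1 2 x \<and> convex_configuration x)
        = solutions_with \<Gamma> (strictly_kite_on_axis 1 2)"
      by (rule solutions_with_implied_conjunct) (use shape12 m im \<open>-2 < 1 / m\<close> in auto)
    thus ?thesis using card12 im by simp
  qed

  have no_kite: False
    if m: "m \<notin> {..<-2} \<union> {-1/2<..<0} \<union> {0<..}" and x: "inj x"
      "unsym_albouy_chenciner (-1) (vortex_strength m) (squared_distances x)" "strictly_kite x" for x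
  proof -
    obtain k l where kl: "strictly_kite_on_axis k l x" using x(3) unfolding strictly_kite_def by blast
    have m': "-2 \<le> m" "m \<le> -1/2" using m \<open>m \<noteq> 0\<close> by auto
    hence "-2 \<le> 1 / m" "1 / m \<le> -1/2" by (simp_all add: field_simps)
    hence empty: "kite_roots m = {}" "kite_roots (1 / m) = {}" using m' kite_roots_empty by blast+
    have "m \<noteq> 1" using m' by simp
    show False
      by (rule strictly_kite_solution_cases[OF \<open>m \<noteq> 0\<close> x(1,2) kl], elim disjE conjE)
        (use empty \<open>m \<noteq> 1\<close> in simp_all)
  qed
  show "solutions_with \<Gamma> strictly_kite = {}" if m: "m \<notin> {..<-2} \<union> {-1/2<..<0} \<union> {0<..}"
  proof -
    have False if "real_positive_solution \<Gamma> (squared_distances x)" "strictly_kite x" for x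
      using no_kite[OF m positive_solution_inj[OF that(1)] _ that(2)] positive_solution_unsym[OF that(1)]
      by (simp add: \<Gamma>_def)
    thus ?thesis by (auto simp: solutions_with_def)
  qed
  show "\<nexists>x lam c. relative_equilibrium \<Gamma> lam c x \<and> lambda_prime \<Gamma> lam < 0 \<and> strictly_kite x"
    if m: "m \<notin> {..<-2} \<union> {-1/2<..<0} \<union> {0<..}"
  proof
    assume "\<exists>x lam c. relative_equilibrium \<Gamma> lam c x \<and> lambda_prime \<Gamma> lam < 0 \<and> strictly_kite x"
    then obtain x lam c where re: "relative_equilibrium \<Gamma> lam c x" and neg: "lambda_prime \<Gamma> lam < 0"
      and kite: "strictly_kite x" by blast
    define b where "b = sqrt (- lambda_prime \<Gamma> lam)"
    have b: "b > 0" using neg by (simp add: b_def)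
    have "(\<Sum>i\<in>UNIV. \<Gamma> i) = 2 * (1 + m)" by (simp add: sum_4 \<Gamma>_def vortex_strength_def)
    hence "(\<Sum>i\<in>UNIV. \<Gamma> i) \<noteq> 0" using \<open>m \<noteq> -1\<close> by simp
    hence "balanced (vortex_strength m) (\<lambda>i. b *\<^sub>R x i)"
      unfolding b_def \<Gamma>_def[symmetric] using relative_equilibrium_imp_balanced re neg by blast
    moreover have "inj (\<lambda>i. b *\<^sub>R x i)" 
      using re b by (auto simp: relative_equilibrium_def inj_def)
    moreover have "strictly_kite (\<lambda>i. b *\<^sub>R x i)"
    proof -
      have "squared_distances (\<lambda>i. b *\<^sub>R x i) s t = b\<^sup>2 * squared_distances x s t" for s t
        unfolding squared_distances_inner
        by (simp add: scaleR_diff_right[symmetric] power2_eq_square mult.assoc)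
      thus ?thesis using kite b unfolding strictly_kite_def strictly_kite_on_axis_def by simp
    qed
    ultimately show False using no_kite[OF m] balanced_imp_unsym by blast
  qed
qed

end
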